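(* Let $\Lambda$ be a countable set of distinct real numbers, let $\mathcal{G}$ be an equivalence class in $\mathcal{F}_{B^2,\Lambda}/\overset{*}{\sim}$, and let $f\in\mathcal{G}$. Then the set of translates $\mathcal{T}_f=\{f_\tau(t):=f(t+\tau):\tau\in\mathbb{R}\}$ is dense in $\mathcal{G}$ with respect to the topology of $B^2(\mathbb{R},\mathbb{C})$.
   Context: For $1\le p<\infty$, the Besicovitch space $B^p(\mathbb{R},\mathbb{C})$ is the completion of the trigonometric polynomials $\sum_{j=1}^n a_je^{i\lambda_jt}$ ($a_j\in\mathbb{C}$, $\lambda_j\in\mathbb{R}$) with respect to the seminorm $\|f\|_{B^p}=\left(\limsup_{l\to\infty}\frac1{2l}\int_{-l}^{l}|f(t)|^p\,dt\right)^{1/p}$; concretely, it consists of the locally $p$-integrable $f:\mathbb{R}\to\mathbb{C}$ such that for every $\varepsilon>0$ there is a trigonometric polynomial $P$ with $\|f-P\|_{B^p}<\varepsilon$. The topology of $B^2(\mathbb{R},\mathbb{C})$ is that of the seminorm $\|\cdot\|_{B^2}$, and functions $f,g\in B^2(\mathbb{R},\mathbb{C})$ with $\|f-g\|_{B^2}=0$ are identified. For $f\in B^1(\mathbb{R},\mathbb{C})\supset B^2(\mathbb{R},\mathbb{C})$ the mean value $M(f)=\lim_{l\to\infty}\frac{1}{2l}\int_{-l}^{l}f(t)\,dt$ exists, and the Fourier coefficient at $\lambda\in\mathbb{R}$ is $a(f,\lambda)=M(f(t)e^{-i\lambda t})$, nonzero for at most countably many $\lambda$. For a countable set $\Lambda=\{\lambda_1,\lambda_2,\ldots\}$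 of distinct real numbers (a set of exponents), $f$ is said to have Fourier series $\sum_{j\ge1}a_je^{i\lambda_jt}$ if $a_j=a(f,\lambda_j)$ for all $j$ (zero values allowed) and $a(f,\lambda)=0$ for $\lambda\notin\Lambda$. $\mathcal{F}_{B^2,\Lambda}$ is the set of $f\in B^2(\mathbb{R},\mathbb{C})$ whose Fourier series is of this form. Equivalence relation: if $f_1,f_2$ have Fourier series $\sum_{j\ge1}a_je^{i\lambda_jt}$ and $\sum_{j\ge1}b_je^{i\lambda_jt}$ with $\lambda_j\in\Lambda$, then $f_1\overset{*}{\sim}f_2$ means that for each integer $n\ge1$ (with $n\le\sharp\Lambda$) there is a $\mathbb{Q}$-linear map $\psi_n:V_n\to\mathbb{R}$, where $V_n$ is the $\mathbb{Q}$-vector space generated by $\{\lambda_1,\ldots,\lambda_n\}$, such that $b_j=a_je^{i\psi_n(\lambda_j)}$ for $j=1,\ldots,n$. *)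

theory Defs
  imports "HOL-Analysis.Analysis"
begin

definition trig_polynomials :: "(real \<Rightarrow> complex) set" where
  "trig_polynomials =
     {P. \<exists>(n::nat) (a :: nat \<Rightarrow> complex) (lam :: nat \<Rightarrow> real).
           P = (\<lambda>t. \<Sum>j=1..n. a j * exp (\<i> * of_real (lam j * t)))}"

definition locally_integrable :: "real \<Rightarrow> (real \<Rightarrow> complex) \<Rightarrow> bool" where
  "locally_integrable p f \<longleftrightarrow>
     f \<in> borel_measurable lebesgue \<and>
     (\<forall>K. compact K \<longrightarrow> set_integrable lebesgue K (\<lambda>t. norm (f t) powr p))"

text \<open>The upper mean of \<open>|f|\<close> to the power \<open>p\<close> may be infinite for a locally \<open>p\<close>-integrable \<open>f\<close>,
  so the seminorm takes values in \<^typ>\<open>ennreal\<close>.\<close>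

definition besicovitch_upper_mean :: "real \<Rightarrow> (real \<Rightarrow> complex) \<Rightarrow> ennreal" where
  "besicovitch_upper_mean p f =
     Limsup at_top (\<lambda>l::real.
       (\<integral>\<^sup>+t\<in>{-l..l}. ennreal (norm (f t) powr p) \<partial>lebesgue) / ennreal (2 * l))"

definition besicovitch_seminorm :: "real \<Rightarrow> (real \<Rightarrow> complex) \<Rightarrow> ennreal" where
  "besicovitch_seminorm p f =
     (if besicovitch_upper_mean p f = \<infinity> then \<infinity>
      else ennreal (enn2real (besicovitch_upper_mean p f) powr (1 / p)))"

definition besicovitch_space :: "real \<Rightarrow> (real \<Rightarrow> complex) set" where
  "besicovitch_space p =
     {f. locally_integrable p f \<and>
         (\<forall>\<epsilon>>0. \<exists>P\<in>trig_polynomials. besicovitch_seminorm p (\<lambda>t. f t - P t) < ennreal \<epsilon>)}"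

text \<open>The seminorm topology, on functions rather than on classes of functions at distance zero.
  Such functions are topologically indistinguishable, so the closure of a set of functions
  corresponds to the closure of its image in the quotient.\<close>

definition besicovitch_open :: "real \<Rightarrow> (real \<Rightarrow> complex) set \<Rightarrow> bool" where
  "besicovitch_open p U \<longleftrightarrow>
     U \<subseteq> besicovitch_space p \<and>
     (\<forall>f\<in>U. \<exists>\<epsilon>>0. \<forall>g\<in>besicovitch_space p.
        besicovitch_seminorm p (\<lambda>t. g t - f t) < ennreal \<epsilon> \<longrightarrow> g \<in> U)"

definition besicovitch_topology :: "real \<Rightarrow> (real \<Rightarrow> complex) topology" where
  "besicovitch_topology p = topology (besicovitch_open p)"

lemma openin_besicovitch_topology:
  "openin (besicovitch_topology p) = besicovitch_open p"
  unfolding besicovitch_topology_def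
proof (rule topology_inverse', unfold istopology_def, intro conjI allI impI)
  fix S T assume S: "besicovitch_open p S" and T: "besicovitch_open p T"
  show "besicovitch_open p (S \<inter> T)"
    unfolding besicovitch_open_def
  proof (intro conjI ballI)
    show "S \<inter> T \<subseteq> besicovitch_space p"
      using S by (auto simp: besicovitch_open_def)
    fix f assume f: "f \<in> S \<inter> T"
    obtain d where d: "d > 0" "\<And>g. g \<in> besicovitch_space p \<Longrightarrow>
        besicovitch_seminorm p (\<lambda>t. g t - f t) < ennreal d \<Longrightarrow> g \<in> S"
      using S f unfolding besicovitch_open_def by blast
    obtain e where e: "e > 0" "\<And>g. g \<in> besicovitch_space p \<Longrightarrow>
        besicovitch_seminorm p (\<lambda>t. g t - f t) < ennreal e \<Longrightarrow> g \<in> T"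
      using T f unfolding besicovitch_open_def by blast
    have "ennreal (min d e) \<le> ennreal d" "ennreal (min d e) \<le> ennreal e"
      by (auto intro: ennreal_leI)
    then show "\<exists>\<epsilon>>0. \<forall>g\<in>besicovitch_space p.
        besicovitch_seminorm p (\<lambda>t. g t - f t) < ennreal \<epsilon> \<longrightarrow> g \<in> S \<inter> T"
      using d e by (intro exI[of _ "min d e"]) (meson IntI less_le_trans min_less_iff_conj)
  qed
next
  fix \<K> assume "\<forall>K\<in>\<K>. besicovitch_open p K"
  then show "besicovitch_open p (\<Union>\<K>)"
    unfolding besicovitch_open_def by (metis Sup_le_iff Union_iff)
qed

lemma topspace_besicovitch_topology: "topspace (besicovitch_topology p) = besicovitch_space p"
proof -
  have "openin (besicovitch_topology p) (besicovitch_space p)"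
    by (auto simp: openin_besicovitch_topology besicovitch_open_def intro: exI[of _ 1])
  then show ?thesis
    by (metis openin_besicovitch_topology besicovitch_open_def openin_subset openin_topspace
        subset_antisym)
qed

definition mean_value :: "(real \<Rightarrow> complex) \<Rightarrow> complex" where
  "mean_value f =
     Lim at_top (\<lambda>l::real. (1 / (2 * l)) *\<^sub>R (LINT t:{-l..l}|lebesgue. f t))"

definition fourier_coeff :: "(real \<Rightarrow> complex) \<Rightarrow> real \<Rightarrow> complex" where
  "fourier_coeff f x = mean_value (\<lambda>t. f t * exp (- \<i> * of_real (x * t)))"

definition exponent_indices :: "real set \<Rightarrow> nat set" where
  "exponent_indices \<Lambda> = {j. 1 \<le> j \<and> (finite \<Lambda> \<longrightarrow> j \<le> card \<Lambda>)}"

definition enumerates_exponents :: "(nat \<Rightarrow> real) \<Rightarrow> real set \<Rightarrow> bool" where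
  "enumerates_exponents lam \<Lambda> \<longleftrightarrow> bij_betw lam (exponent_indices \<Lambda>) \<Lambda>"

definition has_fourier_series ::
    "(nat \<Rightarrow> real) \<Rightarrow> real set \<Rightarrow> (real \<Rightarrow> complex) \<Rightarrow> (nat \<Rightarrow> complex) \<Rightarrow> bool" where
  "has_fourier_series lam \<Lambda> f a \<longleftrightarrow>
     (\<forall>j\<in>exponent_indices \<Lambda>. a j = fourier_coeff f (lam j)) \<and>
     (\<forall>x. x \<notin> \<Lambda> \<longrightarrow> fourier_coeff f x = 0)"

definition besicovitch_exponents :: "(nat \<Rightarrow> real) \<Rightarrow> real set \<Rightarrow> (real \<Rightarrow> complex) set" where
  "besicovitch_exponents lam \<Lambda> =
     {f \<in> besicovitch_space 2. \<exists>a. has_fourier_series lam \<Lambda> f a}"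

global_interpretation rat_vs: vector_space "\<lambda>(q::rat) (x::real). of_rat q * x"
  defines rat_span = rat_vs.span
  by unfold_locales (auto simp: algebra_simps of_rat_add of_rat_mult)

definition rat_linear_on :: "real set \<Rightarrow> (real \<Rightarrow> real) \<Rightarrow> bool" where
  "rat_linear_on V \<psi> \<longleftrightarrow>
     (\<forall>x\<in>V. \<forall>y\<in>V. \<psi> (x + y) = \<psi> x + \<psi> y) \<and>
     (\<forall>q::rat. \<forall>x\<in>V. \<psi> (of_rat q * x) = of_rat q * \<psi> x)"

definition bohr_equiv :: "(nat \<Rightarrow> real) \<Rightarrow> real set \<Rightarrow> ((real \<Rightarrow> complex) \<times> (real \<Rightarrow> complex)) set" where
  "bohr_equiv lam \<Lambda> =
     {(f1, f2). f1 \<in> besicovitch_exponents lam \<Lambda> \<and> f2 \<in> besicovitch_exponents lam \<Lambda> \<and>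
        (\<exists>a b. has_fourier_series lam \<Lambda> f1 a \<and> has_fourier_series lam \<Lambda> f2 b \<and>
           (\<forall>n\<in>exponent_indices \<Lambda>. \<exists>\<psi>. rat_linear_on (rat_span (lam ` {1..n})) \<psi> \<and>
              (\<forall>j\<in>{1..n}. b j = a j * exp (\<i> * of_real (\<psi> (lam j))))))}"

lemma bohr_equiv_altdef:
  "bohr_equiv lam \<Lambda> =
     {(f1, f2). f1 \<in> besicovitch_exponents lam \<Lambda> \<and> f2 \<in> besicovitch_exponents lam \<Lambda> \<and>
        (\<forall>n\<in>exponent_indices \<Lambda>. \<exists>\<psi>. rat_linear_on (rat_span (lam ` {1..n})) \<psi> \<and>
           (\<forall>j\<in>{1..n}. fourier_coeff f2 (lam j) =
              fourier_coeff f1 (lam j) * exp (\<i> * of_real (\<psi> (lam j)))))}"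
proof -
  have idx: "j \<in> exponent_indices \<Lambda>" if "n \<in> exponent_indices \<Lambda>" "j \<in> {1..n}" for n j
    using that by (auto simp: exponent_indices_def)
  have series: "has_fourier_series lam \<Lambda> f (\<lambda>j. fourier_coeff f (lam j))"
    if "f \<in> besicovitch_exponents lam \<Lambda>" for f
    using that by (auto simp: besicovitch_exponents_def has_fourier_series_def)
  have "(\<exists>a b. has_fourier_series lam \<Lambda> f1 a \<and> has_fourier_series lam \<Lambda> f2 b \<and>
           (\<forall>n\<in>exponent_indices \<Lambda>. \<exists>\<psi>. rat_linear_on (rat_span (lam ` {1..n})) \<psi> \<and>
              (\<forall>j\<in>{1..n}. b j = a j * exp (\<i> * of_real (\<psi> (lam j)))))) \<longleftrightarrow>
        (\<forall>n\<in>exponent_indices \<Lambda>. \<exists>\<psi>. rat_linear_on (rat_span (lam ` {1..n})) \<psi> \<and>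
           (\<forall>j\<in>{1..n}. fourier_coeff f2 (lam j) =
              fourier_coeff f1 (lam j) * exp (\<i> * of_real (\<psi> (lam j)))))" (is "?L \<longleftrightarrow> ?R")
    if "f1 \<in> besicovitch_exponents lam \<Lambda>" "f2 \<in> besicovitch_exponents lam \<Lambda>" for f1 f2
  proof
    assume ?L
    then obtain a b where ab: "has_fourier_series lam \<Lambda> f1 a" "has_fourier_series lam \<Lambda> f2 b"
      and *: "\<forall>n\<in>exponent_indices \<Lambda>. \<exists>\<psi>. rat_linear_on (rat_span (lam ` {1..n})) \<psi> \<and>
              (\<forall>j\<in>{1..n}. b j = a j * exp (\<i> * of_real (\<psi> (lam j))))"
      by blast
    show ?R
    proof
      fix n assume n: "n \<in> exponent_indices \<Lambda>"
      have "a j = fourier_coeff f1 (lam j)" "b j = fourier_coeff f2 (lam j)" if "j \<in> {1..n}" for j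
        using ab idx[OF n that] by (auto simp: has_fourier_series_def)
      then show "\<exists>\<psi>. rat_linear_on (rat_span (lam ` {1..n})) \<psi> \<and>
           (\<forall>j\<in>{1..n}. fourier_coeff f2 (lam j) =
              fourier_coeff f1 (lam j) * exp (\<i> * of_real (\<psi> (lam j))))"
        using bspec[OF * n] by force
    qed
  next
    assume ?R
    then show ?L using series[OF that(1)] series[OF that(2)] by blast
  qed
  then show ?thesis
    unfolding bohr_equiv_def by (simp only: set_eq_iff split_paired_All mem_Collect_eq case_prod_conv simp_thms cong: conj_cong)
qed

lemma equiv_bohr_equiv: "equiv (besicovitch_exponents lam \<Lambda>) (bohr_equiv lam \<Lambda>)"
proof (rule equivI)
  show "bohr_equiv lam \<Lambda> \<subseteq> besicovitch_exponents lam \<Lambda> \<times> besicovitch_exponents lam \<Lambda>"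
    by (auto simp: bohr_equiv_def)
  show "refl_on (besicovitch_exponents lam \<Lambda>) (bohr_equiv lam \<Lambda>)"
    by (auto simp: refl_on_def bohr_equiv_altdef rat_linear_on_def intro!: exI[of _ "\<lambda>_. 0"])
  show "sym (bohr_equiv lam \<Lambda>)"
  proof (rule symI)
    fix f g assume fg: "(f, g) \<in> bohr_equiv lam \<Lambda>"
    show "(g, f) \<in> bohr_equiv lam \<Lambda>"
      unfolding bohr_equiv_altdef
    proof (intro CollectI case_prodI conjI ballI)
      fix n assume "n \<in> exponent_indices \<Lambda>"
      then obtain \<psi> where \<psi>: "rat_linear_on (rat_span (lam ` {1..n})) \<psi>"
        "\<And>j. j \<in> {1..n} \<Longrightarrow> fourier_coeff g (lam j) =
           fourier_coeff f (lam j) * exp (\<i> * of_real (\<psi> (lam j)))"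
        using fg unfolding bohr_equiv_altdef by blast
      show "\<exists>\<psi>. rat_linear_on (rat_span (lam ` {1..n})) \<psi> \<and>
           (\<forall>j\<in>{1..n}. fourier_coeff f (lam j) =
              fourier_coeff g (lam j) * exp (\<i> * of_real (\<psi> (lam j))))"
        using \<psi> by (intro exI[of _ "\<lambda>x. - \<psi> x"])
          (auto simp: rat_linear_on_def exp_minus field_simps)
    qed (use fg in \<open>auto simp: bohr_equiv_def\<close>)
  qed
  show "trans (bohr_equiv lam \<Lambda>)"
  proof (rule transI)
    fix f g h assume fg: "(f, g) \<in> bohr_equiv lam \<Lambda>" and gh: "(g, h) \<in> bohr_equiv lam \<Lambda>"
    show "(f, h) \<in> bohr_equiv lam \<Lambda>"
      unfolding bohr_equiv_altdef
    proof (intro CollectI case_prodI conjI ballI)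
      fix n assume n: "n \<in> exponent_indices \<Lambda>"
      obtain \<psi> where \<psi>: "rat_linear_on (rat_span (lam ` {1..n})) \<psi>"
        "\<And>j. j \<in> {1..n} \<Longrightarrow> fourier_coeff g (lam j) =
           fourier_coeff f (lam j) * exp (\<i> * of_real (\<psi> (lam j)))"
        using fg n unfolding bohr_equiv_altdef by blast
      obtain \<phi> where \<phi>: "rat_linear_on (rat_span (lam ` {1..n})) \<phi>"
        "\<And>j. j \<in> {1..n} \<Longrightarrow> fourier_coeff h (lam j) =
           fourier_coeff g (lam j) * exp (\<i> * of_real (\<phi> (lam j)))"
        using gh n unfolding bohr_equiv_altdef by blast
      show "\<exists>\<psi>. rat_linear_on (rat_span (lam ` {1..n})) \<psi> \<and>
           (\<forall>j\<in>{1..n}. fourier_coeff h (lam j) =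
              fourier_coeff f (lam j) * exp (\<i> * of_real (\<psi> (lam j))))"
        using \<psi> \<phi> by (intro exI[of _ "\<lambda>x. \<psi> x + \<phi> x"])
          (auto simp: rat_linear_on_def exp_add algebra_simps)
    qed (use fg gh in \<open>auto simp: bohr_equiv_def\<close>)
  qed
qed

definition translates :: "(real \<Rightarrow> complex) \<Rightarrow> (real \<Rightarrow> complex) set" where
  "translates f = {(\<lambda>t. f (t + \<tau>)) | \<tau>. \<tau> \<in> UNIV}"

end

theory Submission
  imports Defs
begin

text \<open>
  A translate \<open>f\<^sub>\<tau>\<close> has the Fourier coefficients \<open>a(f,x) exp(i x \<tau>)\<close>, and \<open>x \<mapsto> x \<tau>\<close> is
  linear over the rationals; so translates are equivalent to \<open>f\<close>
  (\<open>bohr_equiv_translate\<close>). Conversely, let \<open>g\<close> be equivalent to \<open>f\<close>. In the seminorm of \<open>B\<^sup>2\<close>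
  a function is the limit of its finite Fourier sums (\<open>fourier_sums_converge\<close>), and translation is
  an isometry, so the tails of the Fourier series of \<open>f\<^sub>\<tau>\<close> are small uniformly in \<open>\<tau>\<close>. To bring
  \<open>f\<^sub>\<tau>\<close> close to \<open>g\<close> it is therefore enough to make finitely many phases \<open>exp(i x \<tau>)\<close> close to
  the phases \<open>exp(i \<psi>(x))\<close> of \<open>g\<close> relative to \<open>f\<close>. Since \<open>\<psi>\<close> is linear over the rationals,
  it respects every rational relation between the exponents, and Kronecker's theorem, applied to a
  rational basis of their span, provides such a \<open>\<tau>\<close> (\<open>kronecker_rat_linear\<close>).

  Two elementary devices keep the analysis short. The convergence of Fourier sums is deduced from the
  density of trigonometric polynomials, which is part of the definition of the space: the Fourier sum
  over \<open>F\<close> is the best approximation with exponents in \<open>F\<close>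
  (\<open>fourier_sum_best_approx\<close>), because the mean of the cross term tends to 0. And all estimates
  concern the energies over finite windows, for which
  \<open>|z + w|\<^sup>2 \<le> 2 |z|\<^sup>2 + 2 |w|\<^sup>2\<close> stands in for the triangle inequality.
\<close>

definition window_mean :: "(real \<Rightarrow> complex) \<Rightarrow> real \<Rightarrow> complex" where
  "window_mean f l = (1 / (2 * l)) *\<^sub>R (LINT t:{-l..l}|lebesgue. f t)"

text \<open>The square of the \<open>B\<^sup>2\<close> seminorm of a locally square integrable \<open>f\<close> is the upper limit of
  these energies. Finite windows give real numbers and ordinary integrals, so estimates are made
  window by window and the seminorm enters only through statements that hold eventually.\<close>

definition window_energy :: "(real \<Rightarrow> complex) \<Rightarrow> real \<Rightarrow> real" where
  "window_energy f l = (LINT t:{-l..l}|lebesgue. (norm (f t))\<^sup>2) / (2 * l)"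

text \<open>Indexing by a finite set of exponents, instead of a list of summands, makes the coefficients
  unique and lets two polynomials be put over the same exponents.\<close>

definition trig_poly :: "real set \<Rightarrow> (real \<Rightarrow> complex) \<Rightarrow> real \<Rightarrow> complex" where
  "trig_poly F c = (\<lambda>t. \<Sum>x\<in>F. c x * cis (x * t))"

section \<open>Locally square integrable functions\<close>

text \<open>Every compact set lies in a window, so symmetric windows are enough to test local integrability.\<close>

lemma locally_integrable_2_iff:
  "locally_integrable 2 f \<longleftrightarrow>
     f \<in> borel_measurable lebesgue \<and> (\<forall>l. (\<lambda>t. (norm (f t))\<^sup>2) absolutely_integrable_on {-l..l})"
proof -
  have powr2: "norm z powr 2 = (norm z)\<^sup>2" for z :: complex
    by simp
  have "(\<lambda>t. (norm (f t))\<^sup>2) absolutely_integrable_on K"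
    if "\<forall>l. (\<lambda>t. (norm (f t))\<^sup>2) absolutely_integrable_on {-l..l}" "compact K" for K
  proof -
    obtain B where B: "\<And>x. x \<in> K \<Longrightarrow> norm x \<le> B"
      using compact_imp_bounded[OF \<open>compact K\<close>] unfolding bounded_iff by blast
    then have "K \<subseteq> {-B..B}"
      by (force simp: abs_le_iff)
    moreover have "K \<in> sets lebesgue"
      using \<open>compact K\<close> by (simp add: lmeasurable_compact fmeasurableD)
    ultimately show ?thesis
      using that(1) set_integrable_subset by blast
  qed
  then show ?thesis
    unfolding locally_integrable_def powr2 by (auto simp: compact_Icc)
qed

lemma locally_integrable_2_measurable:
  "locally_integrable 2 f \<Longrightarrow> f \<in> borel_measurable lebesgue"
  by (simp add: locally_integrable_2_iff)

lemma locally_integrable_2_square: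
  "locally_integrable 2 f \<Longrightarrow> (\<lambda>t. (norm (f t))\<^sup>2) absolutely_integrable_on {-l..l}"
  by (simp add: locally_integrable_2_iff)

lemma absolutely_integrable_bounded_by:
  fixes f :: "real \<Rightarrow> complex" and g :: "real \<Rightarrow> real"
  assumes "g absolutely_integrable_on {a..b}" "f \<in> borel_measurable lebesgue"
    and "\<And>t. norm (f t) \<le> g t"
  shows "f absolutely_integrable_on {a..b}"
proof (rule set_integrable_bound[OF assms(1)])
  show "set_borel_measurable lebesgue {a..b} f"
    unfolding set_borel_measurable_def
    by (intro borel_measurable_scaleR borel_measurable_indicator assms(2)) auto
  show "AE t in lebesgue. t \<in> {a..b} \<longrightarrow> norm (f t) \<le> norm (g t)"
    by (rule AE_I2) (use assms(3) in \<open>auto intro: order_trans[OF _ abs_ge_self]\<close>)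
qed

lemma locally_integrable_2_bounded_by:
  fixes f :: "real \<Rightarrow> complex" and g :: "real \<Rightarrow> real"
  assumes "f \<in> borel_measurable lebesgue"
    and "\<And>l. g absolutely_integrable_on {-l..l}"
    and "\<And>t. (norm (f t))\<^sup>2 \<le> g t"
  shows "locally_integrable 2 f"
  unfolding locally_integrable_2_iff
proof (intro conjI allI)
  fix l
  show "(\<lambda>t. (norm (f t))\<^sup>2) absolutely_integrable_on {-l..l}"
  proof (rule set_integrable_bound[OF assms(2)])
    show "set_borel_measurable lebesgue {-l..l} (\<lambda>t. (norm (f t))\<^sup>2)"
      unfolding set_borel_measurable_def
      by (intro borel_measurable_scaleR borel_measurable_indicator borel_measurable_power
          measurable_compose[OF assms(1) borel_measurable_norm]) auto
    show "AE t in lebesgue. t \<in> {-l..l} \<longrightarrow> norm ((norm (f t))\<^sup>2) \<le> norm (g t)"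
      by (rule AE_I2) (use assms(3) in \<open>auto intro: order_trans[OF _ abs_ge_self]\<close>)
  qed
qed (rule assms(1))

text \<open>A substitute for the triangle inequality of the quadratic mean: the factor 2 is harmless, because all that matters is
  which energies can be made small.\<close>

lemma norm_add_squared_le: "(norm (z + w))\<^sup>2 \<le> 2 * (norm z)\<^sup>2 + 2 * (norm w)\<^sup>2"
  for z w :: complex
proof -
  have "(norm (z + w))\<^sup>2 \<le> (norm z + norm w)\<^sup>2"
    by (simp add: norm_triangle_ineq power_mono)
  also have "\<dots> \<le> 2 * (norm z)\<^sup>2 + 2 * (norm w)\<^sup>2"
    using sum_squares_bound[of "norm z" "norm w"] by (simp add: power2_sum)
  finally show ?thesis .
qed

lemma locally_integrable_2_add:
  assumes "locally_integrable 2 f" "locally_integrable 2 g"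
  shows "locally_integrable 2 (\<lambda>t. f t + g t)"
proof (rule locally_integrable_2_bounded_by)
  show "(\<lambda>t. f t + g t) \<in> borel_measurable lebesgue"
    using assms[THEN locally_integrable_2_measurable] by measurable
  show "(\<lambda>t. 2 * (norm (f t))\<^sup>2 + 2 * (norm (g t))\<^sup>2) absolutely_integrable_on {-l..l}" for l
    using assms by (intro set_integral_add set_integrable_mult_right locally_integrable_2_square)
qed (rule norm_add_squared_le)

lemma locally_integrable_2_minus:
  "locally_integrable 2 f \<Longrightarrow> locally_integrable 2 (\<lambda>t. - f t)"
  by (auto simp: locally_integrable_2_iff)

lemma locally_integrable_2_diff:
  assumes "locally_integrable 2 f" "locally_integrable 2 g"
  shows "locally_integrable 2 (\<lambda>t. f t - g t)"
  using locally_integrable_2_add[OF assms(1) locally_integrable_2_minus[OF assms(2)]] by simp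

lemma continuous_measurable_lebesgue:
  fixes f :: "real \<Rightarrow> complex"
  assumes "continuous_on UNIV f"
  shows "f \<in> borel_measurable lebesgue"
  using borel_measurable_continuous_onI[OF assms] by (simp add: measurable_completion)

lemma locally_integrable_2_continuous:
  assumes "continuous_on UNIV f"
  shows "locally_integrable 2 f"
proof -
  have "continuous_on UNIV (\<lambda>t. (norm (f t))\<^sup>2)"
    using assms by (intro continuous_intros)
  then show ?thesis
    unfolding locally_integrable_2_iff
    by (meson absolutely_integrable_continuous_real assms continuous_measurable_lebesgue
        continuous_on_subset subset_UNIV)
qed

lemma continuous_trig_poly: "continuous_on UNIV (trig_poly F c)"
  unfolding trig_poly_def cis_conv_exp by (intro continuous_intros)

lemma locally_integrable_2_trig_poly: "locally_integrable 2 (trig_poly F c)"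
  by (intro locally_integrable_2_continuous continuous_trig_poly)

lemma locally_integrable_2_mult_cis:
  assumes "locally_integrable 2 f"
  shows "locally_integrable 2 (\<lambda>t. f t * cis (x * t))"
proof -
  have "(\<lambda>t. cis (x * t)) \<in> borel_measurable lebesgue"
    by (intro continuous_measurable_lebesgue) (auto simp: cis_conv_exp intro!: continuous_intros)
  then show ?thesis
    using assms by (auto simp: locally_integrable_2_iff norm_mult)
qed

lemma locally_integrable_2_cmult:
  assumes "locally_integrable 2 f"
  shows "locally_integrable 2 (\<lambda>t. c * f t)"
  using assms by (auto simp: locally_integrable_2_iff norm_mult power_mult_distrib)

lemma locally_integrable_2_integrable:
  assumes "locally_integrable 2 f"
  shows "f absolutely_integrable_on {-l..l}"
proof (rule absolutely_integrable_bounded_by)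
  show "(\<lambda>t. 1 + (norm (f t))\<^sup>2) absolutely_integrable_on {-l..l}"
    using assms by (intro set_integral_add locally_integrable_2_square
        absolutely_integrable_continuous_real continuous_intros)
  show "norm (f t) \<le> 1 + (norm (f t))\<^sup>2" for t
    using order_trans[OF mult_right_mono[of 1 2 "norm (f t)"] sum_squares_bound[of 1 "norm (f t)", simplified]]
    by simp
qed (use assms in \<open>rule locally_integrable_2_measurable\<close>)

lemma locally_integrable_2_translate:
  assumes "locally_integrable 2 f"
  shows "locally_integrable 2 (\<lambda>t. f (t + \<tau>))"
  unfolding locally_integrable_2_iff
proof (intro conjI allI)
  show "(\<lambda>t. f (t + \<tau>)) \<in> borel_measurable lebesgue"
    using borel_measurable_affine[OF locally_integrable_2_measurable[OF assms], of 1 \<tau>]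
    by (simp add: add.commute)
  fix l
  have "(\<lambda>t. (norm (f t))\<^sup>2) absolutely_integrable_on {\<tau> - l..\<tau> + l}"
    by (rule set_integrable_subset[OF locally_integrable_2_square[OF assms, of "\<bar>l\<bar> + \<bar>\<tau>\<bar>"]]) auto
  then have "integrable lebesgue (\<lambda>t. indicator {\<tau> - l..\<tau> + l} (\<tau> + 1 * t) *\<^sub>R (norm (f (\<tau> + 1 * t)))\<^sup>2)"
    unfolding set_integrable_def by (rule lebesgue_integrable_real_affine) simp
  then show "(\<lambda>t. (norm (f (t + \<tau>)))\<^sup>2) absolutely_integrable_on {-l..l}"
    unfolding set_integrable_def
    by (rule back_subst[where P="integrable lebesgue"])
       (auto simp: fun_eq_iff indicator_def add.commute)
qed

section \<open>Window energies and the Besicovitch seminorm\<close>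

lemma window_energy_nonneg: "l > 0 \<Longrightarrow> window_energy f l \<ge> 0"
  unfolding window_energy_def set_lebesgue_integral_def
  by (intro divide_nonneg_pos Bochner_Integration.integral_nonneg) auto

text \<open>On locally square integrable functions the nonnegative integral is finite and agrees with the
  Bochner integral.\<close>

lemma besicovitch_upper_mean_eq:
  assumes "locally_integrable 2 f"
  shows "besicovitch_upper_mean 2 f = Limsup at_top (\<lambda>l. ennreal (window_energy f l))"
  unfolding besicovitch_upper_mean_def
proof (rule Limsup_eq)
  show "\<forall>\<^sub>F l in at_top. (\<integral>\<^sup>+t\<in>{-l..l}. ennreal (norm (f t) powr 2) \<partial>lebesgue) / ennreal (2 * l)
      = ennreal (window_energy f l)"
    using eventually_gt_at_top[of "0::real"]
  proof eventually_elim
    case (elim l)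
    have "(\<integral>\<^sup>+t\<in>{-l..l}. ennreal (norm (f t) powr 2) \<partial>lebesgue)
        = (\<integral>\<^sup>+t. ennreal (indicator {-l..l} t *\<^sub>R (norm (f t))\<^sup>2) \<partial>lebesgue)"
      by (intro nn_integral_cong) (auto simp: indicator_def)
    also have "\<dots> = ennreal (LINT t:{-l..l}|lebesgue. (norm (f t))\<^sup>2)"
      unfolding set_lebesgue_integral_def
      using locally_integrable_2_square[OF assms, of l]
      by (intro nn_integral_eq_integral) (auto simp: set_integrable_def)
    finally show ?case
      using elim by (simp add: window_energy_def divide_ennreal set_lebesgue_integral_def)
  qed
qed

text \<open>This and the next lemma translate between the seminorm and eventual bounds on the energies. The
  converse direction needs a gap between the bound \<open>d\<close> and \<open>\<epsilon>\<^sup>2\<close>, as an upper limit may attain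
  a bound that the energies stay strictly below.\<close>

lemma eventually_energy_less_of_seminorm:
  assumes "locally_integrable 2 f" "besicovitch_seminorm 2 f < ennreal \<epsilon>"
  shows "\<forall>\<^sub>F l in at_top. window_energy f l < \<epsilon>\<^sup>2"
proof -
  let ?U = "besicovitch_upper_mean 2 f"
  have fin: "?U \<noteq> \<infinity>" and lt: "ennreal (enn2real ?U powr (1/2)) < ennreal \<epsilon>"
    using assms(2) by (auto simp: besicovitch_seminorm_def split: if_splits)
  have "sqrt (enn2real ?U) < \<epsilon>"
    using lt by (simp add: powr_half_sqrt ennreal_less_iff)
  then have "enn2real ?U < \<epsilon>\<^sup>2"
    by (rule real_sqrt_less_iff[THEN iffD1, OF less_le_trans]) simp
  then have "?U < ennreal (\<epsilon>\<^sup>2)"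
    using fin by (cases ?U) (auto simp: ennreal_less_iff)
  then have "\<forall>\<^sub>F l in at_top. ennreal (window_energy f l) < ennreal (\<epsilon>\<^sup>2)"
    unfolding besicovitch_upper_mean_eq[OF assms(1)] by (rule Limsup_lessD)
  then show ?thesis
    using eventually_gt_at_top[of 0]
    by eventually_elim (use window_energy_nonneg in \<open>auto simp: ennreal_less_iff\<close>)
qed

lemma seminorm_less_of_eventually_energy:
  assumes "locally_integrable 2 f" "0 \<le> d" "d < \<epsilon>\<^sup>2" "\<epsilon> > 0"
    and "\<forall>\<^sub>F l in at_top. window_energy f l \<le> d"
  shows "besicovitch_seminorm 2 f < ennreal \<epsilon>"
proof -
  let ?U = "besicovitch_upper_mean 2 f"
  have U: "?U \<le> ennreal d"
    unfolding besicovitch_upper_mean_eq[OF assms(1)]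
    by (rule Limsup_bounded) (use assms(5) in \<open>eventually_elim, auto intro: ennreal_leI\<close>)
  then have fin: "?U \<noteq> \<infinity>"
    by (auto simp: top_unique)
  have "enn2real ?U \<le> d"
    using U assms(2) by (simp add: enn2real_leI)
  then have "sqrt (enn2real ?U) < \<epsilon>"
    using assms(3,4) by (intro real_less_lsqrt) auto
  then show ?thesis
    using fin by (simp add: besicovitch_seminorm_def powr_half_sqrt ennreal_lessI assms(4))
qed

lemma window_energy_add_le:
  assumes "locally_integrable 2 f" "locally_integrable 2 g" "l > 0"
  shows "window_energy (\<lambda>t. f t + g t) l \<le> 2 * window_energy f l + 2 * window_energy g l"
proof -
  note sq = locally_integrable_2_square
  have "(LINT t:{-l..l}|lebesgue. (norm (f t + g t))\<^sup>2)
      \<le> (LINT t:{-l..l}|lebesgue. 2 * (norm (f t))\<^sup>2 + 2 * (norm (g t))\<^sup>2)"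
    using assms by (intro set_integral_mono set_integral_add set_integrable_mult_right sq
        locally_integrable_2_add norm_add_squared_le)
  also have "\<dots> = 2 * (LINT t:{-l..l}|lebesgue. (norm (f t))\<^sup>2)
      + 2 * (LINT t:{-l..l}|lebesgue. (norm (g t))\<^sup>2)"
    using sq[OF assms(1), of l] sq[OF assms(2), of l] by (subst set_integral_add) auto
  finally show ?thesis
    using assms(3) by (simp add: window_energy_def field_simps)
qed

lemma window_energy_uniform_bound:
  assumes "locally_integrable 2 f" "\<And>t. norm (f t) \<le> \<eta>" "l > 0"
  shows "window_energy f l \<le> \<eta>\<^sup>2"
proof -
  have "(LINT t:{-l..l}|lebesgue. (norm (f t))\<^sup>2) \<le> (LINT t:{-l..l}|lebesgue. \<eta>\<^sup>2)"
    using assms by (intro set_integral_mono locally_integrable_2_square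
        absolutely_integrable_continuous_real continuous_intros power_mono) auto
  also have "\<dots> = 2 * l * \<eta>\<^sup>2"
    using assms(3) by (simp add: set_lebesgue_integral_def)
  finally show ?thesis
    using assms(3) by (simp add: window_energy_def field_simps)
qed

text \<open>The mean of a function is at most its quadratic mean: the pointwise bound \<open>2 \<eta> |f| \<le> \<eta>\<^sup>2 + |f|\<^sup>2\<close> with the fixed weight
  \<open>\<eta>\<close> can be integrated.\<close>

lemma window_mean_norm_le:
  assumes "locally_integrable 2 f" "l > 0" "\<eta> > 0" "window_energy f l \<le> \<eta>\<^sup>2"
  shows "norm (window_mean f l) \<le> \<eta>"
proof -
  have am_gm: "norm (f t) \<le> \<eta> / 2 + (norm (f t))\<^sup>2 / (2 * \<eta>)" for t
  proof -
    have "2 * \<eta> * norm (f t) \<le> \<eta>\<^sup>2 + (norm (f t))\<^sup>2"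
      using sum_squares_bound[of \<eta> "norm (f t)"] by simp
    then show ?thesis
      using assms(3) by (simp add: field_simps power2_eq_square)
  qed
  have int: "(\<lambda>t. (norm (f t))\<^sup>2 / (2 * \<eta>)) absolutely_integrable_on {-l..l}"
    using locally_integrable_2_square[OF assms(1), of l] by simp
  have const: "(\<lambda>t. \<eta> / 2) absolutely_integrable_on {-l..l}"
    by (intro absolutely_integrable_continuous_real continuous_intros)
  have "norm (LINT t:{-l..l}|lebesgue. f t) \<le> (LINT t:{-l..l}|lebesgue. norm (f t))"
    by (intro set_integral_norm_bound locally_integrable_2_integrable assms(1))
  also have "\<dots> \<le> (LINT t:{-l..l}|lebesgue. \<eta> / 2 + (norm (f t))\<^sup>2 / (2 * \<eta>))"
    by (intro set_integral_mono set_integrable_norm set_integral_add locally_integrable_2_integrable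
        assms(1) int const am_gm)
  also have "\<dots> = \<eta> * l + (LINT t:{-l..l}|lebesgue. (norm (f t))\<^sup>2) / (2 * \<eta>)"
  proof -
    have "(LINT t:{-l..l}|lebesgue. \<eta> / 2) = \<eta> * l"
      using assms(2) by (simp add: set_lebesgue_integral_def)
    then show ?thesis
      using int const by (simp add: set_integral_add)
  qed
  finally have "norm (LINT t:{-l..l}|lebesgue. f t) / (2 * l)
      \<le> (\<eta> * l + (LINT t:{-l..l}|lebesgue. (norm (f t))\<^sup>2) / (2 * \<eta>)) / (2 * l)"
    using assms(2) by (intro divide_right_mono) auto
  also have "\<dots> = \<eta> / 2 + window_energy f l / (2 * \<eta>)"
    using assms(2,3) by (simp add: window_energy_def field_simps)
  also have "\<dots> \<le> \<eta> / 2 + \<eta>\<^sup>2 / (2 * \<eta>)"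
    using assms(3,4) by (intro add_left_mono divide_right_mono) auto
  also have "\<dots> = \<eta>"
    using assms(3) by (simp add: power2_eq_square)
  finally show ?thesis
    using assms(2) by (simp add: window_mean_def)
qed

text \<open>The translated window lies in the symmetric window of half length \<open>l + |\<tau>|\<close>; the factor
  corrects the normalisation and tends to 1, whence the translation invariance of the seminorm.\<close>

lemma window_energy_translate_le:
  assumes "locally_integrable 2 f" "l > 0"
  shows "window_energy (\<lambda>t. f (t + \<tau>)) l
     \<le> window_energy f (l + \<bar>\<tau>\<bar>) * (1 + \<bar>\<tau>\<bar> / l)"
proof -
  let ?L = "l + \<bar>\<tau>\<bar>"
  have "(LINT t:{-l..l}|lebesgue. (norm (f (t + \<tau>)))\<^sup>2)
      = (LINT t:{\<tau> - l..\<tau> + l}|lebesgue. (norm (f t))\<^sup>2)"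
    unfolding set_lebesgue_integral_def
    by (subst (2) lebesgue_integral_real_affine[where c=1 and t=\<tau>])
       (auto intro!: Bochner_Integration.integral_cong simp: indicator_def add.commute)
  also have "\<dots> \<le> (LINT t:{-?L..?L}|lebesgue. (norm (f t))\<^sup>2)"
    unfolding set_lebesgue_integral_def
  proof (rule integral_mono)
    show "integrable lebesgue (\<lambda>t. indicator {-?L..?L} t *\<^sub>R (norm (f t))\<^sup>2)"
      using locally_integrable_2_square[OF assms(1), of ?L] by (simp only: set_integrable_def)
    have "(\<lambda>t. (norm (f t))\<^sup>2) absolutely_integrable_on {\<tau> - l..\<tau> + l}"
      by (rule set_integrable_subset[OF locally_integrable_2_square[OF assms(1), of ?L]]) auto
    then show "integrable lebesgue (\<lambda>t. indicator {\<tau> - l..\<tau> + l} t *\<^sub>R (norm (f t))\<^sup>2)"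
      by (simp only: set_integrable_def)
  qed (auto simp: indicator_def)
  finally have "window_energy (\<lambda>t. f (t + \<tau>)) l
      \<le> (LINT t:{-?L..?L}|lebesgue. (norm (f t))\<^sup>2) / (2 * l)"
    unfolding window_energy_def using assms(2) by (intro divide_right_mono) auto
  also have "\<dots> = window_energy f ?L * (1 + \<bar>\<tau>\<bar> / l)"
    using assms(2) by (simp add: window_energy_def divide_simps) 
  finally show ?thesis .
qed

lemma eventually_energy_translate:
  assumes "locally_integrable 2 f" "\<forall>\<^sub>F l in at_top. window_energy f l < c" "c < d"
  shows "\<forall>\<^sub>F l in at_top. window_energy (\<lambda>t. f (t + \<tau>)) l < d"
proof -
  have shift: "filterlim (\<lambda>l. l + \<bar>\<tau>\<bar>) at_top (at_top :: real filter)"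
    by (rule filterlim_at_top_mono[OF filterlim_ident]) auto
  have "((\<lambda>l. c * (1 + \<bar>\<tau>\<bar> / l)) \<longlongrightarrow> c * (1 + 0)) at_top"
    by (intro tendsto_intros tendsto_divide_0[OF tendsto_const] filterlim_at_top_imp_at_infinity
        filterlim_ident)
  then have "\<forall>\<^sub>F l in at_top. c * (1 + \<bar>\<tau>\<bar> / l) < d"
    using assms(3) by (auto dest: order_tendstoD(2))
  moreover have "\<forall>\<^sub>F l in at_top. window_energy f (l + \<bar>\<tau>\<bar>) < c"
    using eventually_compose_filterlim[OF assms(2) shift] .
  ultimately show ?thesis
    using eventually_gt_at_top[of 0]
  proof eventually_elim
    case (elim l)
    have "window_energy f (l + \<bar>\<tau>\<bar>) * (1 + \<bar>\<tau>\<bar> / l) \<le> c * (1 + \<bar>\<tau>\<bar> / l)"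
      using elim by (intro mult_right_mono) auto
    then show ?case
      using window_energy_translate_le[OF assms(1) elim(3), of \<tau>] elim(1) by linarith
  qed
qed

section \<open>Trigonometric polynomials\<close>

text \<open>Equal exponents are merged by adding their coefficients.\<close>

lemma trig_polynomials_iff:
  "P \<in> trig_polynomials \<longleftrightarrow> (\<exists>F c. finite F \<and> P = trig_poly F c)"
proof
  assume "P \<in> trig_polynomials"
  then obtain n :: nat and a lam where P: "P = (\<lambda>t. \<Sum>j=1..n. a j * exp (\<i> * of_real (lam j * t)))"
    unfolding trig_polynomials_def mem_Collect_eq by blast
  define c where "c x = (\<Sum>j | j \<in> {1..n} \<and> lam j = x. a j)" for x
  have "P t = trig_poly (lam ` {1..n}) c t" for t
  proof -
    have "P t = (\<Sum>j\<in>{1..n}. a j * cis (lam j * t))"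
      by (simp add: P cis_conv_exp)
    also have "\<dots> = (\<Sum>x\<in>lam ` {1..n}. \<Sum>j | j \<in> {1..n} \<and> lam j = x. a j * cis (lam j * t))"
      by (rule sum.image_gen) simp
    also have "\<dots> = trig_poly (lam ` {1..n}) c t"
      unfolding trig_poly_def c_def sum_distrib_right by (intro sum.cong) auto
    finally show ?thesis .
  qed
  then show "\<exists>F c. finite F \<and> P = trig_poly F c"
    by (intro exI[of _ "lam ` {1..n}"] exI[of _ c]) auto
next
  assume "\<exists>F c. finite F \<and> P = trig_poly F c"
  then obtain F c where F: "finite F" and P: "P = trig_poly F c"
    by blast
  obtain h where h: "bij_betw h {1..card F} F"
    using ex_bij_betw_nat_finite_1[OF F] by blast
  have "P = (\<lambda>t. \<Sum>j=1..card F. c (h j) * exp (\<i> * of_real (h j * t)))"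
    unfolding P trig_poly_def cis_conv_exp
    by (rule ext) (rule sum.reindex_bij_betw[OF h, symmetric])
  then show "P \<in> trig_polynomials"
    unfolding trig_polynomials_def mem_Collect_eq
    by (intro exI[of _ "card F"] exI[of _ "\<lambda>j. c (h j)"] exI[of _ h])
qed

lemma besicovitch_space_2_iff:
  "f \<in> besicovitch_space 2 \<longleftrightarrow> locally_integrable 2 f \<and>
     (\<forall>e>0. \<exists>F c. finite F \<and>
        (\<forall>\<^sub>F l in at_top. window_energy (\<lambda>t. f t - trig_poly F c t) l < e))"
    (is "_ \<longleftrightarrow> _ \<and> ?approx")
proof (cases "locally_integrable 2 f")
  case True
  have diff: "locally_integrable 2 (\<lambda>t. f t - trig_poly F c t)" for F c
    by (intro locally_integrable_2_diff True locally_integrable_2_trig_poly)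
  have ?approx if B2: "f \<in> besicovitch_space 2"
  proof (intro allI impI)
    fix e :: real assume "e > 0"
    then have "sqrt e > 0" by simp
    then obtain P where P: "P \<in> trig_polynomials"
      "besicovitch_seminorm 2 (\<lambda>t. f t - P t) < ennreal (sqrt e)"
      using B2 unfolding besicovitch_space_def by blast
    obtain F c where F: "finite F" "P = trig_poly F c"
      using P(1) trig_polynomials_iff by blast
    show "\<exists>F c. finite F \<and> (\<forall>\<^sub>F l in at_top. window_energy (\<lambda>t. f t - trig_poly F c t) l < e)"
      using eventually_energy_less_of_seminorm[OF diff P(2)[unfolded F(2)]] F(1) \<open>e > 0\<close>
      by auto
  qed
  moreover have "f \<in> besicovitch_space 2" if ?approx
    unfolding besicovitch_space_def
  proof (intro CollectI conjI allI impI True)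
    fix \<epsilon> :: real assume \<epsilon>: "\<epsilon> > 0"
    then have "\<epsilon>\<^sup>2 / 2 > 0" by simp
    then obtain F c where F: "finite F"
      "\<forall>\<^sub>F l in at_top. window_energy (\<lambda>t. f t - trig_poly F c t) l < \<epsilon>\<^sup>2 / 2"
      using \<open>?approx\<close> by blast
    have "besicovitch_seminorm 2 (\<lambda>t. f t - trig_poly F c t) < ennreal \<epsilon>"
    proof (rule seminorm_less_of_eventually_energy[OF diff])
      show "\<forall>\<^sub>F l in at_top. window_energy (\<lambda>t. f t - trig_poly F c t) l \<le> \<epsilon>\<^sup>2 / 2"
        using F(2) by eventually_elim simp
    qed (use \<epsilon> in auto)
    then show "\<exists>P\<in>trig_polynomials. besicovitch_seminorm 2 (\<lambda>t. f t - P t) < ennreal \<epsilon>"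
      using F(1) trig_polynomials_iff by blast
  qed
  ultimately show ?thesis
    using True by blast
qed (simp add: besicovitch_space_def)

lemma besicovitch_space_2_locally_integrable:
  "f \<in> besicovitch_space 2 \<Longrightarrow> locally_integrable 2 f"
  by (simp add: besicovitch_space_def)

lemma trig_poly_in_besicovitch_space: "finite F \<Longrightarrow> trig_poly F c \<in> besicovitch_space 2"
  unfolding besicovitch_space_2_iff
proof (intro conjI allI impI locally_integrable_2_trig_poly)
  fix e :: real assume "e > 0" "finite F"
  then show "\<exists>F' c'. finite F' \<and>
      (\<forall>\<^sub>F l in at_top. window_energy (\<lambda>t. trig_poly F c t - trig_poly F' c' t) l < e)"
    by (intro exI[of _ F] exI[of _ c]) (simp add: window_energy_def)
qed

lemma trig_poly_translate:
  "trig_poly F c (t + \<tau>) = trig_poly F (\<lambda>x. c x * cis (x * \<tau>)) t"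
  unfolding trig_poly_def by (intro sum.cong) (auto simp: cis_mult algebra_simps)

lemma trig_poly_extend:
  assumes "finite F'" "F \<subseteq> F'" "\<And>x. x \<in> F' - F \<Longrightarrow> d x = 0" "\<And>x. x \<in> F \<Longrightarrow> d x = c x"
  shows "trig_poly F' d = trig_poly F c"
  unfolding trig_poly_def
  by (rule ext, rule sum.mono_neutral_cong_right) (use assms in auto)

section \<open>Fourier coefficients\<close>

lemma window_mean_add:
  assumes "locally_integrable 2 f" "locally_integrable 2 g"
  shows "window_mean (\<lambda>t. f t + g t) l = window_mean f l + window_mean g l"
  unfolding window_mean_def
  using assms[THEN locally_integrable_2_integrable, of l]
  by (simp add: set_integral_add scaleR_add_right)

lemma window_mean_diff:
  assumes "locally_integrable 2 f" "locally_integrable 2 g"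
  shows "window_mean (\<lambda>t. f t - g t) l = window_mean f l - window_mean g l"
  unfolding window_mean_def
  using assms[THEN locally_integrable_2_integrable, of l]
  by (simp add: set_integral_diff scaleR_diff_right)

lemma window_mean_cmult: "window_mean (\<lambda>t. c * f t) l = c * window_mean f l"
  unfolding window_mean_def by simp

lemma locally_integrable_2_sum:
  assumes "\<And>x. x \<in> F \<Longrightarrow> locally_integrable 2 (f x)"
  shows "locally_integrable 2 (\<lambda>t. \<Sum>x\<in>F. f x t)"
  using assms
proof (induction F rule: infinite_finite_induct)
  case (insert x F)
  then show ?case
    by (simp add: locally_integrable_2_add)
qed (simp_all add: locally_integrable_2_continuous)

lemma window_mean_sum:
  assumes "\<And>x. x \<in> F \<Longrightarrow> locally_integrable 2 (f x)"
  shows "window_mean (\<lambda>t. \<Sum>x\<in>F. f x t) l = (\<Sum>x\<in>F. window_mean (f x) l)"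
  using assms
proof (induction F rule: infinite_finite_induct)
  case (insert x F)
  then show ?case
    by (simp add: window_mean_add locally_integrable_2_sum)
qed (simp_all add: window_mean_def)

text \<open>Orthogonality of the characters: for \<open>x \<noteq> 0\<close> the integral over any window is at most
  \<open>2 / |x|\<close>, which the normalisation \<open>1 / (2 l)\<close> sends to 0.\<close>

lemma window_mean_cis_tendsto:
  "(window_mean (\<lambda>t. cis (x * t)) \<longlongrightarrow> (if x = 0 then 1 else 0)) at_top"
proof (cases "x = 0")
  case True
  have "\<forall>\<^sub>F l in at_top. 1 = window_mean (\<lambda>t. cis (x * t)) l"
    using eventually_gt_at_top[of 0]
    by eventually_elim (simp add: True window_mean_def set_lebesgue_integral_def scaleR_conv_of_real)
  then show ?thesis
    using True by (auto intro: Lim_transform_eventually[OF tendsto_const])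
next
  case False
  have "((\<lambda>l. inverse \<bar>x\<bar> * inverse l) \<longlongrightarrow> inverse \<bar>x\<bar> * 0) at_top"
    by (intro tendsto_intros tendsto_inverse_0_at_top filterlim_ident)
  then have lim: "((\<lambda>l. inverse \<bar>x\<bar> * inverse l) \<longlongrightarrow> 0) at_top"
    by simp
  have "\<forall>\<^sub>F l in at_top. norm (window_mean (\<lambda>t. cis (x * t)) l) \<le> inverse \<bar>x\<bar> * inverse l"
    using eventually_gt_at_top[of 0]
  proof eventually_elim
    case (elim l)
    have "((\<lambda>t. cis (x * t) / (\<i> * of_real x)) has_vector_derivative cis (x * t)) (at t within {-l..l})" for t
    proof -
      have "((\<lambda>z. exp (\<i> * of_real x * z) / (\<i> * of_real x)) has_field_derivative
          exp (\<i> * of_real x * of_real t)) (at (of_real t))"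
        using False by (auto intro!: derivative_eq_intros)
      then show ?thesis
        by (auto dest: has_vector_derivative_real_field simp: cis_conv_exp mult.assoc)
    qed
    then have "((\<lambda>t. cis (x * t)) has_integral
        cis (x * l) / (\<i> * of_real x) - cis (x * (- l)) / (\<i> * of_real x)) {-l..l}"
      using elim by (intro fundamental_theorem_of_calculus) auto
    moreover have "(\<lambda>t. cis (x * t)) absolutely_integrable_on {-l..l}"
      unfolding cis_conv_exp by (intro absolutely_integrable_continuous_real continuous_intros)
    ultimately have "(LINT t:{-l..l}|lebesgue. cis (x * t))
        = cis (x * l) / (\<i> * of_real x) - cis (x * (- l)) / (\<i> * of_real x)"
      by (simp add: set_lebesgue_integral_eq_integral integral_unique)
    also have "norm \<dots> \<le> 1 / \<bar>x\<bar> + 1 / \<bar>x\<bar>"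
      by (rule norm_triangle_le_diff) (simp add: norm_divide norm_mult)
    finally have "norm (LINT t:{-l..l}|lebesgue. cis (x * t)) / (2 * l) \<le> (2 / \<bar>x\<bar>) / (2 * l)"
      using elim by (intro divide_right_mono) auto
    then show ?case
      using elim by (simp add: window_mean_def field_simps)
  qed
  then show ?thesis
    using False lim by (auto intro: Lim_null_comparison)
qed

lemma window_mean_trig_poly_tendsto:
  assumes "finite F"
  shows "(window_mean (\<lambda>t. trig_poly F c t * cis (- y * t)) \<longlongrightarrow> (if y \<in> F then c y else 0)) at_top"
proof -
  have eq: "trig_poly F c t * cis (- y * t) = (\<Sum>x\<in>F. c x * cis ((x - y) * t))" for t
    unfolding trig_poly_def sum_distrib_right
    by (intro sum.cong) (auto simp: cis_mult algebra_simps)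
  have windows: "window_mean (\<lambda>t. trig_poly F c t * cis (- y * t))
      = (\<lambda>l. \<Sum>x\<in>F. c x * window_mean (\<lambda>t. cis ((x - y) * t)) l)"
    unfolding eq
    by (rule ext, subst window_mean_sum)
       (auto simp: window_mean_cmult cis_conv_exp intro!: locally_integrable_2_continuous continuous_intros)
  have "((\<lambda>l. \<Sum>x\<in>F. c x * window_mean (\<lambda>t. cis ((x - y) * t)) l)
      \<longlongrightarrow> (\<Sum>x\<in>F. c x * (if x - y = 0 then 1 else 0))) at_top"
    by (intro tendsto_intros window_mean_cis_tendsto)
  moreover have "(\<Sum>x\<in>F. c x * (if x - y = 0 then 1 else 0)) = (if y \<in> F then c y else 0)"
    using assms by (simp add: if_distrib cong: if_cong)
  ultimately show ?thesis
    unfolding windows by (simp only:)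
qed

lemma window_mean_cis_diff_le:
  assumes "locally_integrable 2 f" "locally_integrable 2 g" "l > 0" "\<eta> > 0"
    and "window_energy (\<lambda>t. f t - g t) l \<le> \<eta>\<^sup>2"
  shows "norm (window_mean (\<lambda>t. f t * cis (x * t)) l - window_mean (\<lambda>t. g t * cis (x * t)) l) \<le> \<eta>"
proof -
  have "window_mean (\<lambda>t. f t * cis (x * t)) l - window_mean (\<lambda>t. g t * cis (x * t)) l
      = window_mean (\<lambda>t. (f t - g t) * cis (x * t)) l"
    by (simp add: window_mean_diff[symmetric] locally_integrable_2_mult_cis assms(1,2) left_diff_distrib)
  also have "norm \<dots> \<le> \<eta>"
    using assms
    by (intro window_mean_norm_le locally_integrable_2_mult_cis locally_integrable_2_diff)
       (auto simp: window_energy_def norm_mult)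
  finally show ?thesis .
qed

lemma fourier_coeff_eq_Lim:
  "fourier_coeff f x = Lim at_top (window_mean (\<lambda>t. f t * cis (- x * t)))"
  by (simp add: fourier_coeff_def mean_value_def window_mean_def[abs_def] cis_conv_exp)

text \<open>The coefficient is defined by an operator that returns an unspecified value when there is no limit,
  so existence has to be shown. The window means of \<open>f\<close> are eventually close to those of an
  approximating trigonometric polynomial, which converge; hence they satisfy the Cauchy criterion.\<close>

lemma fourier_coeff_tendsto:
  assumes "f \<in> besicovitch_space 2"
  shows "(window_mean (\<lambda>t. f t * cis (- x * t)) \<longlongrightarrow> fourier_coeff f x) at_top"
proof -
  let ?m = "window_mean (\<lambda>t. f t * cis (- x * t))"
  have f: "locally_integrable 2 f"
    using assms by (rule besicovitch_space_2_locally_integrable)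
  have "cauchy_filter (filtermap ?m at_top)"
    unfolding cauchy_filter_metric_filtermap
  proof (intro allI impI)
    fix e :: real assume e: "e > 0"
    then have "(e / 4)\<^sup>2 > 0" by simp
    then obtain F c where F: "finite F"
      and fP: "\<forall>\<^sub>F l in at_top. window_energy (\<lambda>t. f t - trig_poly F c t) l < (e / 4)\<^sup>2"
      using assms unfolding besicovitch_space_2_iff by blast
    let ?p = "if x \<in> F then c x else 0"
    have "\<forall>\<^sub>F l in at_top. dist (window_mean (\<lambda>t. trig_poly F c t * cis (- x * t)) l) ?p < e / 4"
      using window_mean_trig_poly_tendsto[OF F, of c x] e by (intro tendstoD) auto
    then have "\<forall>\<^sub>F l in at_top. dist (?m l) ?p < e / 2"
      using fP eventually_gt_at_top[of 0]
    proof eventually_elim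
      case (elim l)
      have "dist (?m l) (window_mean (\<lambda>t. trig_poly F c t * cis (- x * t)) l) \<le> e / 4"
        unfolding dist_norm using elim e
        by (intro window_mean_cis_diff_le f locally_integrable_2_trig_poly) auto
      then show ?case
        using elim(1) by metric
    qed
    moreover have "dist (?m l) (?m l') < e" if "dist (?m l) ?p < e / 2" "dist (?m l') ?p < e / 2" for l l'
      using that by metric
    ultimately show "\<exists>P. eventually P at_top \<and> (\<forall>l l'. P l \<and> P l' \<longrightarrow> dist (?m l) (?m l') < e)"
      by (intro exI[of _ "\<lambda>l. dist (?m l) ?p < e / 2"]) blast
  qed
  then obtain z where "filtermap ?m at_top \<le> nhds z"
    using cauchy_filter_complete_converges[of "filtermap ?m at_top" UNIV]
    by (auto simp: complete_UNIV filtermap_bot_iff)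
  then have z: "(?m \<longlongrightarrow> z) at_top"
    by (simp add: filterlim_def)
  then show ?thesis
    using tendsto_Lim[OF _ z] by (simp add: fourier_coeff_eq_Lim)
qed

lemma fourier_coeff_trig_poly:
  assumes "finite F"
  shows "fourier_coeff (trig_poly F c) x = (if x \<in> F then c x else 0)"
  unfolding fourier_coeff_eq_Lim
  by (rule tendsto_Lim[OF _ window_mean_trig_poly_tendsto[OF assms]]) simp

text \<open>Fourier coefficients are continuous in the seminorm, uniformly in the frequency.\<close>

lemma fourier_coeff_diff_le:
  assumes "f \<in> besicovitch_space 2" "g \<in> besicovitch_space 2" "\<eta> > 0"
    and "\<forall>\<^sub>F l in at_top. window_energy (\<lambda>t. f t - g t) l < \<eta>\<^sup>2"
  shows "norm (fourier_coeff f x - fourier_coeff g x) \<le> \<eta>"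
proof (rule Lim_norm_ubound)
  show "((\<lambda>l. window_mean (\<lambda>t. f t * cis (- x * t)) l - window_mean (\<lambda>t. g t * cis (- x * t)) l)
      \<longlongrightarrow> fourier_coeff f x - fourier_coeff g x) at_top"
    by (intro tendsto_diff fourier_coeff_tendsto assms)
  show "\<forall>\<^sub>F l in at_top. norm (window_mean (\<lambda>t. f t * cis (- x * t)) l
      - window_mean (\<lambda>t. g t * cis (- x * t)) l) \<le> \<eta>"
    using assms(4) eventually_gt_at_top[of 0]
    by eventually_elim
       (intro window_mean_cis_diff_le besicovitch_space_2_locally_integrable less_imp_le assms)
qed simp

section \<open>Translation\<close>

text \<open>Translation acts on a trigonometric polynomial by multiplying the coefficient at \<open>x\<close> by
  \<open>cis (x * \<tau>)\<close> and does not change the seminorm, so an approximation of \<open>f\<close> can be carried along.\<close>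

lemma translate_approx:
  assumes "locally_integrable 2 f"
    and "\<forall>\<^sub>F l in at_top. window_energy (\<lambda>t. f t - trig_poly F c t) l < e" "e < e'"
  shows "\<forall>\<^sub>F l in at_top.
    window_energy (\<lambda>t. f (t + \<tau>) - trig_poly F (\<lambda>x. c x * cis (x * \<tau>)) t) l < e'"
  using eventually_energy_translate[OF _ assms(2,3), of \<tau>] assms(1)
  by (simp add: trig_poly_translate locally_integrable_2_diff locally_integrable_2_trig_poly)

lemma besicovitch_space_translate:
  assumes "f \<in> besicovitch_space 2"
  shows "(\<lambda>t. f (t + \<tau>)) \<in> besicovitch_space 2"
  unfolding besicovitch_space_2_iff
proof (intro conjI allI impI)
  have f: "locally_integrable 2 f"
    using assms by (rule besicovitch_space_2_locally_integrable)
  then show "locally_integrable 2 (\<lambda>t. f (t + \<tau>))"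
    by (rule locally_integrable_2_translate)
  fix e :: real assume "e > 0"
  then have "e / 2 > 0" "e / 2 < e" by auto
  then obtain F c where "finite F" "\<forall>\<^sub>F l in at_top. window_energy (\<lambda>t. f t - trig_poly F c t) l < e / 2"
    using assms unfolding besicovitch_space_2_iff by blast
  then show "\<exists>F c. finite F \<and> (\<forall>\<^sub>F l in at_top. window_energy (\<lambda>t. f (t + \<tau>) - trig_poly F c t) l < e)"
    using translate_approx[OF f _ \<open>e / 2 < e\<close>] by blast
qed

text \<open>Clear for trigonometric polynomials; both sides are continuous in the seminorm, so it extends to
  their limits.\<close>

lemma fourier_coeff_translate:
  assumes "f \<in> besicovitch_space 2"
  shows "fourier_coeff (\<lambda>t. f (t + \<tau>)) x = fourier_coeff f x * cis (x * \<tau>)"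
proof -
  have f: "locally_integrable 2 f"
    using assms by (rule besicovitch_space_2_locally_integrable)
  let ?a = "fourier_coeff (\<lambda>t. f (t + \<tau>)) x" and ?b = "fourier_coeff f x * cis (x * \<tau>)"
  have "norm (?a - ?b) \<le> 0"
  proof (rule field_le_epsilon)
    fix e :: real assume e: "e > 0"
    then have "(e / 4)\<^sup>2 > 0" and less: "(e / 4)\<^sup>2 < (e / 2)\<^sup>2"
      by (auto simp: power_strict_mono)
    then obtain F c where F: "finite F"
      and fP: "\<forall>\<^sub>F l in at_top. window_energy (\<lambda>t. f t - trig_poly F c t) l < (e / 4)\<^sup>2"
      using assms unfolding besicovitch_space_2_iff by blast
    let ?p = "fourier_coeff (trig_poly F c) x"
    have "norm (?a - fourier_coeff (trig_poly F (\<lambda>x. c x * cis (x * \<tau>))) x) \<le> e / 2"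
      using e translate_approx[OF f fP less]
      by (intro fourier_coeff_diff_le besicovitch_space_translate assms trig_poly_in_besicovitch_space F) auto
    then have "norm (?a - ?p * cis (x * \<tau>)) \<le> e / 2"
      by (simp only: fourier_coeff_trig_poly F) (simp split: if_splits)
    moreover have "norm (fourier_coeff f x - ?p) \<le> e / 4"
      using e fP by (intro fourier_coeff_diff_le assms trig_poly_in_besicovitch_space F) auto
    then have "norm (?b - ?p * cis (x * \<tau>)) \<le> e / 4"
      by (simp add: left_diff_distrib[symmetric] norm_mult)
    ultimately show "norm (?a - ?b) \<le> 0 + e"
      using norm_triangle_ineq4[of "?a - ?p * cis (x * \<tau>)" "?b - ?p * cis (x * \<tau>)"] e by simp
  qed
  then show ?thesis by simp
qed

section \<open>Best approximation by Fourier sums\<close>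

text \<open>The expansion of \<open>|h + D|\<^sup>2\<close> with the term \<open>|D|\<^sup>2\<close> dropped.\<close>

lemma window_energy_add_ge:
  assumes "locally_integrable 2 h" "locally_integrable 2 D" "l > 0"
    and "locally_integrable 2 (\<lambda>t. h t * cnj (D t))"
  shows "window_energy h l + 2 * Re (window_mean (\<lambda>t. h t * cnj (D t)) l)
    \<le> window_energy (\<lambda>t. h t + D t) l"
proof -
  note sq = locally_integrable_2_square
  have cross: "(\<lambda>t. h t * cnj (D t)) absolutely_integrable_on {-l..l}"
    by (rule locally_integrable_2_integrable[OF assms(4)])
  then have Re_int: "(\<lambda>t. Re (h t * cnj (D t))) absolutely_integrable_on {-l..l}"
    and Re_eq: "(LINT t:{-l..l}|lebesgue. Re (h t * cnj (D t)))
      = Re (LINT t:{-l..l}|lebesgue. h t * cnj (D t))"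
    using integrable_Re[of lebesgue "\<lambda>t. indicator {-l..l} t *\<^sub>R (h t * cnj (D t))"]
      integral_Re[of lebesgue "\<lambda>t. indicator {-l..l} t *\<^sub>R (h t * cnj (D t))"]
    unfolding set_integrable_def set_lebesgue_integral_def by simp_all
  have "(LINT t:{-l..l}|lebesgue. (norm (h t))\<^sup>2) + 2 * Re (LINT t:{-l..l}|lebesgue. h t * cnj (D t))
      = (LINT t:{-l..l}|lebesgue. (norm (h t))\<^sup>2 + 2 * Re (h t * cnj (D t)))"
    using sq[OF assms(1), of l] Re_int
    by (subst set_integral_add) (auto simp only: set_integral_mult_right Re_eq set_integrable_mult_right)
  also have "\<dots> \<le> (LINT t:{-l..l}|lebesgue. (norm (h t + D t))\<^sup>2)"
  proof (intro set_integral_mono set_integral_add set_integrable_mult_right sq Re_int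
      locally_integrable_2_add assms(1,2))
    fix t
    have "0 \<le> (Re (D t))\<^sup>2 + (Im (D t))\<^sup>2" by simp
    then show "(norm (h t))\<^sup>2 + 2 * Re (h t * cnj (D t)) \<le> (norm (h t + D t))\<^sup>2"
      by (simp add: cmod_power2 power2_sum algebra_simps)
  qed
  finally have "((LINT t:{-l..l}|lebesgue. (norm (h t))\<^sup>2)
        + 2 * Re (LINT t:{-l..l}|lebesgue. h t * cnj (D t))) / (2 * l)
      \<le> (LINT t:{-l..l}|lebesgue. (norm (h t + D t))\<^sup>2) / (2 * l)"
    using assms(3) by (intro divide_right_mono) auto
  then show ?thesis
    by (simp add: window_energy_def window_mean_def add_divide_distrib)
qed

text \<open>Among the trigonometric polynomials with exponents in \<open>F\<close>, the Fourier sum is nearest to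
  \<open>f\<close>. The remainder \<open>h\<close> has vanishing Fourier coefficients on \<open>F\<close>, so its inner product
  with any such polynomial \<open>D\<close> has mean tending to 0, and adding \<open>D\<close> to \<open>h\<close> cannot lower the
  limiting energy.\<close>

lemma fourier_sum_best_approx:
  assumes f: "f \<in> besicovitch_space 2" and F: "finite F"
    and P: "\<forall>\<^sub>F l in at_top. window_energy (\<lambda>t. f t - trig_poly F c t) l < e" and "e < e'"
  shows "\<forall>\<^sub>F l in at_top. window_energy (\<lambda>t. f t - trig_poly F (fourier_coeff f) t) l < e'"
proof -
  let ?a = "fourier_coeff f"
  define h where "h t = f t - trig_poly F ?a t" for t
  define d where "d x = ?a x - c x" for x
  have fL: "locally_integrable 2 f"
    using f by (rule besicovitch_space_2_locally_integrable)
  have hL: "locally_integrable 2 h"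
    unfolding h_def by (intro locally_integrable_2_diff fL locally_integrable_2_trig_poly)
  have hD: "h t + trig_poly F d t = f t - trig_poly F c t" for t
    by (simp add: h_def d_def trig_poly_def sum_subtractf left_diff_distrib)
  have cross_eq: "h t * cnj (trig_poly F d t) = (\<Sum>x\<in>F. cnj (d x) * (h t * cis (- x * t)))" for t
    by (simp add: trig_poly_def sum_distrib_left cis_cnj mult_ac)
  have crossL: "locally_integrable 2 (\<lambda>t. h t * cnj (trig_poly F d t))"
    unfolding cross_eq
    by (intro locally_integrable_2_sum locally_integrable_2_cmult locally_integrable_2_mult_cis hL)
  have "(window_mean (\<lambda>t. h t * cis (- x * t)) \<longlongrightarrow> 0) at_top" if "x \<in> F" for x
  proof -
    have "((\<lambda>l. window_mean (\<lambda>t. f t * cis (- x * t)) l - window_mean (\<lambda>t. trig_poly F ?a t * cis (- x * t)) l)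
        \<longlongrightarrow> ?a x - (if x \<in> F then ?a x else 0)) at_top"
      by (intro tendsto_diff fourier_coeff_tendsto f window_mean_trig_poly_tendsto F)
    moreover have "window_mean (\<lambda>t. h t * cis (- x * t))
        = (\<lambda>l. window_mean (\<lambda>t. f t * cis (- x * t)) l - window_mean (\<lambda>t. trig_poly F ?a t * cis (- x * t)) l)"
      unfolding h_def left_diff_distrib
      by (intro ext window_mean_diff locally_integrable_2_mult_cis fL locally_integrable_2_trig_poly)
    moreover have "?a x - (if x \<in> F then ?a x else 0) = 0"
      using that by simp
    ultimately show ?thesis
      by (simp only:)
  qed
  then have "((\<lambda>l. \<Sum>x\<in>F. cnj (d x) * window_mean (\<lambda>t. h t * cis (- x * t)) l)
      \<longlongrightarrow> (\<Sum>x\<in>F. cnj (d x) * 0)) at_top"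
    by (intro tendsto_sum tendsto_mult tendsto_const)
  moreover have "window_mean (\<lambda>t. h t * cnj (trig_poly F d t))
      = (\<lambda>l. \<Sum>x\<in>F. cnj (d x) * window_mean (\<lambda>t. h t * cis (- x * t)) l)"
    unfolding cross_eq window_mean_cmult[symmetric]
    by (intro ext window_mean_sum locally_integrable_2_cmult locally_integrable_2_mult_cis hL)
  ultimately have "(window_mean (\<lambda>t. h t * cnj (trig_poly F d t)) \<longlongrightarrow> 0) at_top"
    by (simp only: mult_zero_right sum.neutral_const)
  then have "\<forall>\<^sub>F l in at_top. dist (window_mean (\<lambda>t. h t * cnj (trig_poly F d t)) l) 0 < (e' - e) / 2"
    using \<open>e < e'\<close> by (intro tendstoD) auto
  then have "\<forall>\<^sub>F l in at_top. window_energy h l < e'"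
    using P eventually_gt_at_top[of 0]
  proof eventually_elim
    case (elim l)
    define R where "R = Re (window_mean (\<lambda>t. h t * cnj (trig_poly F d t)) l)"
    have "window_energy h l + 2 * R < e"
      using window_energy_add_ge[OF hL locally_integrable_2_trig_poly elim(3) crossL] elim(2)
      by (simp add: hD R_def)
    moreover have "\<bar>R\<bar> < (e' - e) / 2"
      unfolding R_def using elim(1) by (intro le_less_trans[OF abs_Re_le_cmod]) simp
    then have "- (2 * R) < e' - e"
      by (simp add: abs_less_iff field_simps)
    ultimately show ?case by simp
  qed
  then show ?thesis
    by (simp add: h_def[abs_def])
qed

text \<open>An approximating polynomial may use exponents outside \<open>\<Lambda>\<close>. The Fourier sum over
  \<open>F\<close> and these exponents together is at least as good an approximation, and in it the exponents
  outside \<open>\<Lambda>\<close> carry the coefficient 0. Having convergence for every large finite \<open>F\<close> allows two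
  functions to be approximated over the same exponents.\<close>

lemma fourier_sums_converge:
  assumes f: "f \<in> besicovitch_space 2" and "e > 0"
    and vanish: "\<And>x. x \<notin> \<Lambda> \<Longrightarrow> fourier_coeff f x = 0"
  obtains F\<^sub>0 where "finite F\<^sub>0" "F\<^sub>0 \<subseteq> \<Lambda>"
    "\<And>F. finite F \<Longrightarrow> F\<^sub>0 \<subseteq> F \<Longrightarrow> F \<subseteq> \<Lambda> \<Longrightarrow>
       \<forall>\<^sub>F l in at_top. window_energy (\<lambda>t. f t - trig_poly F (fourier_coeff f) t) l < e"
proof -
  have "e / 2 > 0" using \<open>e > 0\<close> by simp
  then obtain K c where K: "finite K"
    and P: "\<forall>\<^sub>F l in at_top. window_energy (\<lambda>t. f t - trig_poly K c t) l < e / 2"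
    using f unfolding besicovitch_space_2_iff by blast
  show thesis
  proof (rule that[of "K \<inter> \<Lambda>"])
    fix F assume F: "finite F" "K \<inter> \<Lambda> \<subseteq> F" "F \<subseteq> \<Lambda>"
    have "trig_poly (F \<union> K) (\<lambda>x. if x \<in> K then c x else 0) = trig_poly K c"
      by (rule trig_poly_extend) (use F(1) K in auto)
    then have "\<forall>\<^sub>F l in at_top.
        window_energy (\<lambda>t. f t - trig_poly (F \<union> K) (\<lambda>x. if x \<in> K then c x else 0) t) l < e / 2"
      using P by simp
    then have "\<forall>\<^sub>F l in at_top. window_energy (\<lambda>t. f t - trig_poly (F \<union> K) (fourier_coeff f) t) l < e"
      using F(1) K \<open>e > 0\<close>
      by (intro fourier_sum_best_approx[OF f, of "F \<union> K" _ "e / 2"]) auto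
    moreover have "trig_poly (F \<union> K) (fourier_coeff f) = trig_poly F (fourier_coeff f)"
      by (rule trig_poly_extend) (use F K vanish in auto)
    ultimately show "\<forall>\<^sub>F l in at_top. window_energy (\<lambda>t. f t - trig_poly F (fourier_coeff f) t) l < e"
      by simp
  qed (use K in auto)
qed

section \<open>Kronecker's theorem for rational linear maps\<close>

text \<open>Kronecker's theorem asks for independence over the integers of the numbers that it treats; a basis
  over the rationals stays independent after division by a common denominator.\<close>

lemma rat_independent_imp_int_independent:
  assumes "rat_vs.independent B" "q \<noteq> 0"
  shows "module.independent (\<lambda>r. (*) (real_of_int r)) ((\<lambda>b. b / real_of_int q) ` B)"
proof -
  interpret Z: Modules.module "\<lambda>r. (*) (real_of_int r)"
    by (simp add: Modules.module.intro distrib_left mult.commute)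
  show ?thesis
    unfolding Z.independent_explicit_module
  proof (intro allI impI)
    fix t u v
    assume t: "finite t" "t \<subseteq> (\<lambda>b. b / real_of_int q) ` B"
      and sum: "(\<Sum>v\<in>t. real_of_int (u v) * v) = 0" and v: "v \<in> t"
    let ?s = "\<lambda>v::real. real_of_int q * v"
    have inj: "inj_on ?s t"
      using assms(2) by (auto simp: inj_on_def)
    have "?s ` t \<subseteq> B"
      using t(2) assms(2) by force
    moreover have "(\<Sum>b\<in>?s ` t. of_rat (of_int (u (b / of_int q))) * b) = 0"
    proof -
      have "(\<Sum>b\<in>?s ` t. of_rat (of_int (u (b / of_int q))) * b)
          = real_of_int q * (\<Sum>v\<in>t. real_of_int (u v) * v)"
        using assms(2) by (subst sum.reindex[OF inj]) (simp add: mult_ac sum_distrib_left)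
      then show ?thesis
        using sum by simp
    qed
    ultimately have "(of_int (u (?s v / of_int q)) :: rat) = 0"
      using t(1) v
      by (intro rat_vs.independent_explicit_module[THEN iffD1, rule_format, OF assms(1),
            of "?s ` t" "\<lambda>b. of_int (u (b / of_int q))"]) auto
    then show "u v = 0"
      using assms(2) by simp
  qed
qed

lemma rat_linear_on_sum:
  assumes "rat_linear_on V \<psi>" "rat_vs.subspace V" "finite B" "B \<subseteq> V"
  shows "\<psi> (\<Sum>b\<in>B. of_rat (r b) * b) = (\<Sum>b\<in>B. of_rat (r b) * \<psi> b)"
  using assms(3,4)
proof (induction B rule: finite_induct)
  case empty
  have "\<psi> (of_rat 0 * 0) = of_rat 0 * \<psi> 0"
    using assms(1) rat_vs.subspace_0[OF assms(2)] unfolding rat_linear_on_def by blast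
  then show ?case by simp
next
  case (insert b B)
  have "(\<Sum>b\<in>B. of_rat (r b) * b) \<in> V" "of_rat (r b) * b \<in> V"
    using insert.prems assms(2)
    by (auto intro!: rat_vs.subspace_sum rat_vs.subspace_scale)
  then show ?case
    using insert assms(1) by (simp add: rat_linear_on_def)
qed

lemma common_denominator:
  assumes "finite (R :: rat set)"
  obtains q :: int where "q > 0" "\<And>r. r \<in> R \<Longrightarrow> \<exists>n::int. r * of_int q = of_int n"
  using assms
proof (induction R arbitrary: thesis rule: finite_induct)
  case empty
  show ?case by (rule empty[of 1]) auto
next
  case (insert r R)
  obtain q :: int where q: "q > 0" "\<And>r. r \<in> R \<Longrightarrow> \<exists>n::int. r * of_int q = of_int n"
    using insert.IH by blast
  obtain a d :: int where ad: "d > 0" "r = of_int a / of_int d"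
    by (cases r) (auto simp: Fract_of_int_quotient)
  show ?case
  proof (rule insert.prems)
    show "q * d > 0" using q ad by simp
    fix s assume "s \<in> insert r R"
    then show "\<exists>n::int. s * of_int (q * d) = of_int n"
    proof
      assume "s = r"
      then have "s * of_int (q * d) = of_int (a * q)"
        using ad by simp
      then show ?thesis by blast
    next
      assume "s \<in> R"
      then obtain n :: int where "s * of_int q = of_int n"
        using q(2) by blast
      then have "s * of_int (q * d) = of_int (n * d)"
        by simp
      then show ?thesis by blast
    qed
  qed
qed

lemma norm_cis_diff_le: "norm (cis a - cis b) \<le> \<bar>a - b\<bar>"
proof -
  have "cis a - cis b = cis b * (cis (a - b) - 1)"
    by (simp add: right_diff_distrib cis_mult)
  then have "norm (cis a - cis b) = norm (exp (\<i> * of_real (a - b)) - 1)"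
    by (simp add: norm_mult cis_conv_exp)
  also have "\<dots> \<le> \<bar>a - b\<bar>"
    using dist_exp_i_1[of "a - b"] abs_sin_x_le_abs_x[of "(a - b) / 2"] by simp
  finally show ?thesis .
qed

text \<open>The numbers in \<open>A\<close> may be rationally dependent, so Kronecker's theorem does not apply to them.
  Choose a rational basis \<open>B\<close> of their span and a common denominator \<open>q\<close> of all coordinates.
  Then the numbers \<open>b / q\<close> are independent, and each \<open>x \<in> A\<close> and its image \<open>\<psi> x\<close> are the same
  integer combination of the \<open>b / q\<close> and of the \<open>\<psi> b / q\<close> respectively. A \<open>\<tau>\<close> that brings
  \<open>\<tau> b / q\<close> close to \<open>\<psi> b / q\<close> modulo \<open>2 \<pi>\<close> for all \<open>b\<close> therefore does the same for
  \<open>\<tau> x\<close> and \<open>\<psi> x\<close>. Integrality of the combination is what preserves congruence modulo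
  \<open>2 \<pi>\<close>; rational coefficients would not.\<close>

lemma kronecker_rat_linear:
  assumes "finite A" "rat_linear_on (rat_span A) \<psi>" "\<delta> > 0"
  obtains \<tau> where "\<And>x. x \<in> A \<Longrightarrow> norm (cis (x * \<tau>) - cis (\<psi> x)) < \<delta>"
proof -
  obtain B where B: "B \<subseteq> A" "rat_vs.independent B" "A \<subseteq> rat_vs.span B"
    using rat_vs.maximal_independent_subset[of A] by blast
  have finB: "finite B"
    using B(1) assms(1) finite_subset by blast
  have "\<exists>r. x = (\<Sum>b\<in>B. of_rat (r b) * b)" if "x \<in> A" for x
    using B(3) that rat_vs.span_finite[OF finB] by auto
  then obtain r where r: "\<And>x. x \<in> A \<Longrightarrow> x = (\<Sum>b\<in>B. of_rat (r x b) * b)"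
    by metis
  obtain q :: int where q: "q > 0"
    "\<And>s. s \<in> (\<lambda>(x, b). r x b) ` (A \<times> B) \<Longrightarrow> \<exists>n::int. s * of_int q = of_int n"
    using common_denominator[of "(\<lambda>(x, b). r x b) ` (A \<times> B)"] assms(1) finB by blast
  then have "\<forall>x\<in>A. \<forall>b\<in>B. \<exists>n::int. r x b * of_int q = of_int n"
    by force
  then obtain n :: "real \<Rightarrow> real \<Rightarrow> int"
    where n: "\<And>x b. x \<in> A \<Longrightarrow> b \<in> B \<Longrightarrow> r x b * of_int q = of_int (n x b)"
    by metis
  have r_n: "(of_rat (r x b) :: real) = of_int (n x b) / of_int q" if "x \<in> A" "b \<in> B" for x b
  proof -
    have "(of_rat (r x b) :: real) * of_int q = of_int (n x b)"
      using arg_cong[OF n[OF that], of "of_rat :: rat \<Rightarrow> real"] by (simp add: of_rat_mult)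
    then show ?thesis
      using q(1) by (simp add: field_simps)
  qed
  have psi: "\<psi> x = (\<Sum>b\<in>B. of_int (n x b) * (\<psi> b / of_int q))" if "x \<in> A" for x
  proof -
    have "\<psi> x = (\<Sum>b\<in>B. of_rat (r x b) * \<psi> b)"
      using rat_linear_on_sum[OF assms(2) rat_vs.subspace_span finB, of "r x"] B(1) r[OF that]
        rat_vs.span_superset[of A] by auto
    then show ?thesis
      using r_n[OF that] by simp
  qed
  have x_eq: "x = (\<Sum>b\<in>B. of_int (n x b) * (b / of_int q))" if "x \<in> A" for x
    using r[OF that] r_n[OF that] by simp
  obtain m \<theta> where \<theta>: "bij_betw \<theta> {..<m::nat} B"
    using ex_bij_betw_nat_finite[OF finB] by (metis lessThan_atLeast0)
  \<comment> \<open>The error for \<open>x\<close> is at most the sum of \<open>|n x b|\<close> times the error for the basis; the 1 keeps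
    \<open>C\<close> positive and the final inequality strict.\<close>
  define C where "C = 1 + (\<Sum>x\<in>A. \<Sum>b\<in>B. \<bar>real_of_int (n x b)\<bar>)"
  have C: "(\<Sum>b\<in>B. \<bar>real_of_int (n x b)\<bar>) < C" if "x \<in> A" for x
    unfolding C_def using member_le_sum[OF that, of "\<lambda>x. \<Sum>b\<in>B. \<bar>real_of_int (n x b)\<bar>"] assms(1)
    by (auto intro!: sum_nonneg)
  have Cpos: "C > 0"
    unfolding C_def by (intro add_pos_nonneg sum_nonneg) auto
  have ind: "module.independent (\<lambda>r. (*) (real_of_int r)) ((\<lambda>i. \<theta> i / real_of_int q) ` {..<m})"
    using rat_independent_imp_int_independent[OF B(2), of q] q(1)
    unfolding bij_betw_imp_surj_on[OF \<theta>, symmetric] image_image by simp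
  have inj: "inj_on (\<lambda>i. \<theta> i / real_of_int q) {..<m}"
    using \<theta> q(1) by (auto simp: bij_betw_def inj_on_def)
  obtain t h where th: "\<And>i. i < m \<Longrightarrow>
      \<bar>t * (\<theta> i / real_of_int q) - of_int (h i) - \<psi> (\<theta> i) / of_int q / (2 * pi)\<bar> < \<delta> / (2 * pi * C)"
    using Kronecker_thm_1[OF ind inj, of "\<delta> / (2 * pi * C)" "\<lambda>i. \<psi> (\<theta> i) / of_int q / (2 * pi)"]
      assms(3) Cpos by (auto simp: field_simps)
  \<comment> \<open>Kronecker's theorem works modulo 1 and on an enumeration; both are undone here.\<close>
  define k where "k b = h (the_inv_into {..<m} \<theta> b)" for b
  have close: "\<bar>2 * pi * t * (b / of_int q) - 2 * pi * of_int (k b) - \<psi> b / of_int q\<bar> < \<delta> / C"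
    if b: "b \<in> B" for b
  proof -
    obtain i where i: "i < m" "b = \<theta> i"
      using bij_betw_imp_surj_on[OF \<theta>] b by auto
    have k: "k b = h i"
      using \<theta> i by (simp add: k_def bij_betw_def the_inv_into_f_f)
    have "2 * pi * t * (b / of_int q) - 2 * pi * of_int (k b) - \<psi> b / of_int q
        = 2 * pi * (t * (\<theta> i / real_of_int q) - of_int (h i) - \<psi> (\<theta> i) / of_int q / (2 * pi))"
      unfolding i(2)[symmetric] k by (simp add: algebra_simps)
    then have "\<bar>2 * pi * t * (b / of_int q) - 2 * pi * of_int (k b) - \<psi> b / of_int q\<bar>
        = 2 * pi * \<bar>t * (\<theta> i / real_of_int q) - of_int (h i) - \<psi> (\<theta> i) / of_int q / (2 * pi)\<bar>"
      by (simp add: abs_mult)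
    also have "\<dots> < 2 * pi * (\<delta> / (2 * pi * C))"
      using th[OF i(1)] by (intro mult_strict_left_mono) auto
    finally show ?thesis by simp
  qed
  show thesis
  proof (rule that)
    fix x assume x: "x \<in> A"
    \<comment> \<open>An integer, so adding \<open>2 \<pi> N\<close> to \<open>\<psi> x\<close> does not change \<open>cis\<close>.\<close>
    define N where "N = (\<Sum>b\<in>B. n x b * k b)"
    have "cis (\<psi> x) = cis (\<psi> x + 2 * pi * of_int N)"
      by (simp flip: cis_mult)
    then have "norm (cis (x * (2 * pi * t)) - cis (\<psi> x)) \<le> \<bar>x * (2 * pi * t) - (\<psi> x + 2 * pi * of_int N)\<bar>"
      using norm_cis_diff_le[of "x * (2 * pi * t)" "\<psi> x + 2 * pi * of_int N"] by (simp only:)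
    also have "x * (2 * pi * t) - (\<psi> x + 2 * pi * of_int N)
        = (\<Sum>b\<in>B. of_int (n x b) * (2 * pi * t * (b / of_int q) - 2 * pi * of_int (k b) - \<psi> b / of_int q))"
    proof -
      have "(\<Sum>b\<in>B. of_int (n x b) * (2 * pi * t * (b / of_int q) - 2 * pi * of_int (k b) - \<psi> b / of_int q))
          = (\<Sum>b\<in>B. 2 * pi * t * (of_int (n x b) * (b / of_int q)) - of_int (n x b) * (\<psi> b / of_int q)
              - 2 * pi * of_int (n x b * k b))"
        by (intro sum.cong) (simp_all add: algebra_simps)
      also have "\<dots> = 2 * pi * t * (\<Sum>b\<in>B. of_int (n x b) * (b / of_int q))
          - (\<Sum>b\<in>B. of_int (n x b) * (\<psi> b / of_int q)) - 2 * pi * of_int N"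
        by (simp only: N_def sum_subtractf sum_distrib_left of_int_sum)
      also have "\<dots> = 2 * pi * t * x - \<psi> x - 2 * pi * of_int N"
        by (simp only: psi[OF x, symmetric] x_eq[OF x, symmetric])
      finally show ?thesis by (simp add: mult_ac)
    qed
    also have "\<bar>\<dots>\<bar> \<le> (\<Sum>b\<in>B. \<bar>real_of_int (n x b)\<bar> * (\<delta> / C))"
      by (intro order_trans[OF sum_abs] sum_mono)
         (unfold abs_mult, intro mult_left_mono less_imp_le[OF close], auto)
    also have "\<dots> = (\<Sum>b\<in>B. \<bar>real_of_int (n x b)\<bar>) * (\<delta> / C)"
      by (rule sum_distrib_right[symmetric])
    also have "\<dots> < C * (\<delta> / C)"
      using C[OF x] assms(3) Cpos by (intro mult_strict_right_mono) auto
    finally show "norm (cis (x * (2 * pi * t)) - cis (\<psi> x)) < \<delta>"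
      using Cpos by simp
  qed
qed

section \<open>Density of the translates\<close>

lemma besicovitch_exponents_iff:
  "f \<in> besicovitch_exponents lam \<Lambda> \<longleftrightarrow>
     f \<in> besicovitch_space 2 \<and> (\<forall>x. x \<notin> \<Lambda> \<longrightarrow> fourier_coeff f x = 0)"
  by (auto simp: besicovitch_exponents_def has_fourier_series_def)

text \<open>The linear map \<open>x \<mapsto> x \<tau>\<close> serves for every \<open>n\<close> at once.\<close>

lemma bohr_equiv_translate:
  assumes "f \<in> besicovitch_exponents lam \<Lambda>"
  shows "(f, \<lambda>t. f (t + \<tau>)) \<in> bohr_equiv lam \<Lambda>"
proof -
  have f: "f \<in> besicovitch_space 2" "\<And>x. x \<notin> \<Lambda> \<Longrightarrow> fourier_coeff f x = 0"
    using assms by (auto simp: besicovitch_exponents_iff)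
  then have "(\<lambda>t. f (t + \<tau>)) \<in> besicovitch_exponents lam \<Lambda>"
    by (simp add: besicovitch_exponents_iff besicovitch_space_translate fourier_coeff_translate)
  moreover have "rat_linear_on V (\<lambda>x. x * \<tau>)" for V
    by (simp add: rat_linear_on_def algebra_simps)
  ultimately show ?thesis
    using assms f(1) unfolding bohr_equiv_altdef
    by (auto simp: fourier_coeff_translate cis_conv_exp intro!: exI[of _ "\<lambda>x. x * \<tau>"])
qed

text \<open>The equivalence provides a linear map for each initial segment of the enumeration, and every finite
  set of exponents lies in one. The empty set is treated apart because \<open>\<Lambda>\<close> may be empty and then
  there is no index \<open>n\<close> to use.\<close>

lemma bohr_equiv_phases:
  assumes "(f, g) \<in> bohr_equiv lam \<Lambda>" "enumerates_exponents lam \<Lambda>" "finite F\<^sub>0" "F\<^sub>0 \<subseteq> \<Lambda>"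
  obtains F \<psi> where "finite F" "F\<^sub>0 \<subseteq> F" "F \<subseteq> \<Lambda>" "rat_linear_on (rat_span F) \<psi>"
    "\<And>x. x \<in> F \<Longrightarrow> fourier_coeff g x = fourier_coeff f x * cis (\<psi> x)"
proof (cases "F\<^sub>0 = {}")
  case True
  then show thesis
    by (intro that[of "{}" "\<lambda>_. 0"]) (auto simp: rat_linear_on_def)
next
  case False
  have lam: "lam ` exponent_indices \<Lambda> = \<Lambda>"
    using assms(2) by (simp add: enumerates_exponents_def bij_betw_def)
  then obtain J where J: "J \<subseteq> exponent_indices \<Lambda>" "finite J" "F\<^sub>0 = lam ` J"
    using finite_subset_image[OF assms(3)] assms(4) by metis
  define n where "n = Max J"
  have "n \<in> J"
    using J False by (simp add: n_def)
  then have n: "n \<in> exponent_indices \<Lambda>" and Jn: "J \<subseteq> {1..n}"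
    using J by (auto simp: n_def exponent_indices_def)
  have sub: "{1..n} \<subseteq> exponent_indices \<Lambda>"
    using n by (auto simp: exponent_indices_def)
  obtain \<psi> where \<psi>: "rat_linear_on (rat_span (lam ` {1..n})) \<psi>"
    "\<And>j. j \<in> {1..n} \<Longrightarrow> fourier_coeff g (lam j) = fourier_coeff f (lam j) * exp (\<i> * of_real (\<psi> (lam j)))"
    using assms(1) n unfolding bohr_equiv_altdef by blast
  show thesis
  proof (rule that[OF _ _ _ \<psi>(1)])
    show "F\<^sub>0 \<subseteq> lam ` {1..n}" "lam ` {1..n} \<subseteq> \<Lambda>"
      using J(3) Jn sub lam by blast+
  qed (use \<psi>(2) in \<open>auto simp: cis_conv_exp\<close>)
qed

text \<open>The difference splits as
  \<open>(f\<^sub>\<tau> - S) + ((S - T) + (T - g))\<close>, where \<open>S\<close> and \<open>T\<close> are the Fourier sums of \<open>f\<^sub>\<tau>\<close> and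
  \<open>g\<close> over a common \<open>F\<close>. The outer terms are small for every \<open>\<tau>\<close>, so \<open>\<tau>\<close> can be chosen
  afterwards to make the finitely many phases in \<open>S - T\<close> agree.\<close>

lemma translates_approximate:
  assumes fg: "(f, g) \<in> bohr_equiv lam \<Lambda>" and lam: "enumerates_exponents lam \<Lambda>" and "e > 0"
  obtains \<tau> where "\<forall>\<^sub>F l in at_top. window_energy (\<lambda>t. f (t + \<tau>) - g t) l < e"
proof -
  have f: "f \<in> besicovitch_space 2" "\<And>x. x \<notin> \<Lambda> \<Longrightarrow> fourier_coeff f x = 0"
    and g: "g \<in> besicovitch_space 2" "\<And>x. x \<notin> \<Lambda> \<Longrightarrow> fourier_coeff g x = 0"
    using fg by (auto simp: bohr_equiv_def besicovitch_exponents_iff)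
  have fL: "locally_integrable 2 f" and gL: "locally_integrable 2 g"
    using f(1) g(1) by (auto intro: besicovitch_space_2_locally_integrable)
  have e16: "e / 16 > 0" using \<open>e > 0\<close> by simp
  obtain F\<^sub>1 where F\<^sub>1: "finite F\<^sub>1" "F\<^sub>1 \<subseteq> \<Lambda>"
    "\<And>F. finite F \<Longrightarrow> F\<^sub>1 \<subseteq> F \<Longrightarrow> F \<subseteq> \<Lambda> \<Longrightarrow>
       \<forall>\<^sub>F l in at_top. window_energy (\<lambda>t. f t - trig_poly F (fourier_coeff f) t) l < e / 16"
    using fourier_sums_converge[OF f(1) e16 f(2)] by blast
  obtain F\<^sub>2 where F\<^sub>2: "finite F\<^sub>2" "F\<^sub>2 \<subseteq> \<Lambda>"
    "\<And>F. finite F \<Longrightarrow> F\<^sub>2 \<subseteq> F \<Longrightarrow> F \<subseteq> \<Lambda> \<Longrightarrow>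
       \<forall>\<^sub>F l in at_top. window_energy (\<lambda>t. g t - trig_poly F (fourier_coeff g) t) l < e / 16"
    using fourier_sums_converge[OF g(1) e16 g(2)] by blast
  obtain F \<psi> where F: "finite F" "F\<^sub>1 \<union> F\<^sub>2 \<subseteq> F" "F \<subseteq> \<Lambda>"
    and \<psi>: "rat_linear_on (rat_span F) \<psi>"
      "\<And>x. x \<in> F \<Longrightarrow> fourier_coeff g x = fourier_coeff f x * cis (\<psi> x)"
    using bohr_equiv_phases[OF fg lam, of "F\<^sub>1 \<union> F\<^sub>2"] F\<^sub>1(1,2) F\<^sub>2(1,2) by (metis Un_least finite_UnI)
  define \<eta> where "\<eta> = sqrt e / 4"
  have \<eta>: "\<eta> > 0" "\<eta>\<^sup>2 = e / 16"
    using \<open>e > 0\<close> by (auto simp: \<eta>_def power_divide)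
  \<comment> \<open>The 1 makes \<open>M\<close> nonzero when all coefficients on \<open>F\<close> vanish.\<close>
  define M where "M = 1 + (\<Sum>x\<in>F. norm (fourier_coeff f x))"
  have M: "M > 0"
    unfolding M_def by (intro add_pos_nonneg sum_nonneg) auto
  obtain \<tau> where \<tau>: "\<And>x. x \<in> F \<Longrightarrow> norm (cis (x * \<tau>) - cis (\<psi> x)) < \<eta> / M"
    using kronecker_rat_linear[OF F(1) \<psi>(1), of "\<eta> / M"] \<eta>(1) M by (metis divide_pos_pos)
  let ?S = "trig_poly F (\<lambda>x. fourier_coeff f x * cis (x * \<tau>))"
  let ?T = "trig_poly F (fourier_coeff g)"
  have SL: "locally_integrable 2 ?S" and TL: "locally_integrable 2 ?T"
    by (intro locally_integrable_2_trig_poly)+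
  have uniform: "norm (?S t - ?T t) \<le> \<eta>" for t
  proof -
    have "?S t - ?T t = (\<Sum>x\<in>F. fourier_coeff f x * (cis (x * \<tau>) - cis (\<psi> x)) * cis (x * t))"
      unfolding trig_poly_def sum_subtractf[symmetric]
      by (intro sum.cong) (auto simp: \<psi>(2) algebra_simps)
    also have "norm \<dots> \<le> (\<Sum>x\<in>F. norm (fourier_coeff f x) * (\<eta> / M))"
      by (intro order_trans[OF norm_sum] sum_mono)
         (auto simp: norm_mult simp del: times_divide_eq_right intro!: mult_left_mono less_imp_le[OF \<tau>])
    also have "\<dots> = (\<Sum>x\<in>F. norm (fourier_coeff f x)) * (\<eta> / M)"
      by (rule sum_distrib_right[symmetric])
    also have "\<dots> \<le> M * (\<eta> / M)"
      using \<eta>(1) M by (intro mult_right_mono) (auto simp: M_def)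
    finally show ?thesis
      using M by simp
  qed
  have f_tail: "\<forall>\<^sub>F l in at_top. window_energy (\<lambda>t. f (t + \<tau>) - ?S t) l < e / 8"
    by (rule translate_approx[OF fL F\<^sub>1(3)]) (use F \<open>e > 0\<close> in auto)
  have g_tail: "\<forall>\<^sub>F l in at_top. window_energy (\<lambda>t. g t - ?T t) l < e / 16"
    using F by (intro F\<^sub>2(3)) auto
  have "\<forall>\<^sub>F l in at_top. window_energy (\<lambda>t. f (t + \<tau>) - g t) l < e"
    using f_tail g_tail eventually_gt_at_top[of 0]
  proof eventually_elim
    case (elim l)
    have "window_energy (\<lambda>t. (?S t - ?T t) + (?T t - g t)) l
        \<le> 2 * window_energy (\<lambda>t. ?S t - ?T t) l + 2 * window_energy (\<lambda>t. ?T t - g t) l"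
      by (intro window_energy_add_le locally_integrable_2_diff SL TL gL elim(3))
    moreover have "window_energy (\<lambda>t. ?S t - ?T t) l \<le> e / 16"
      unfolding \<eta>(2)[symmetric]
      by (intro window_energy_uniform_bound locally_integrable_2_diff SL TL uniform elim(3))
    moreover have "window_energy (\<lambda>t. ?T t - g t) l = window_energy (\<lambda>t. g t - ?T t) l"
      by (simp add: window_energy_def norm_minus_commute)
    moreover have "window_energy (\<lambda>t. (f (t + \<tau>) - ?S t) + ((?S t - ?T t) + (?T t - g t))) l
        \<le> 2 * window_energy (\<lambda>t. f (t + \<tau>) - ?S t) l
          + 2 * window_energy (\<lambda>t. (?S t - ?T t) + (?T t - g t)) l"
      by (intro window_energy_add_le locally_integrable_2_diff locally_integrable_2_add
          locally_integrable_2_translate fL SL TL gL elim(3))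
    moreover have "(\<lambda>t. (f (t + \<tau>) - ?S t) + ((?S t - ?T t) + (?T t - g t))) = (\<lambda>t. f (t + \<tau>) - g t)"
      by simp
    ultimately show ?case
      using elim(1,2) \<open>e > 0\<close> by simp
  qed
  then show thesis
    by (rule that)
qed

theorem theorem2:
  fixes \<Lambda> :: "real set" and lam :: "nat \<Rightarrow> real"
    and G :: "(real \<Rightarrow> complex) set" and f :: "real \<Rightarrow> complex"
  assumes "countable \<Lambda>"
    and "enumerates_exponents lam \<Lambda>"
    and "G \<in> besicovitch_exponents lam \<Lambda> // bohr_equiv lam \<Lambda>"
    and "f \<in> G"
  shows "translates f \<subseteq> G \<and>
         subtopology (besicovitch_topology 2) G closure_of translates f = G"
proof -
  obtain f\<^sub>0 where "G = bohr_equiv lam \<Lambda> `` {f\<^sub>0}"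
    using assms(3) by (rule quotientE)
  then have G: "G = bohr_equiv lam \<Lambda> `` {f}"
    using assms(4) equiv_class_eq[OF equiv_bohr_equiv] by blast
  have G_space: "G \<subseteq> besicovitch_space 2" and f: "f \<in> besicovitch_exponents lam \<Lambda>"
    using G assms(4) by (auto simp: bohr_equiv_def besicovitch_exponents_def)
  have translates: "translates f \<subseteq> G"
    using bohr_equiv_translate[OF f] by (auto simp: G translates_def)
  have space: "topspace (subtopology (besicovitch_topology 2) G) = G"
    using G_space by (auto simp: topspace_besicovitch_topology)
  have "g \<in> subtopology (besicovitch_topology 2) G closure_of translates f" if "g \<in> G" for g
    unfolding in_closure_of space
  proof (intro conjI allI impI that)
    fix T assume "g \<in> T \<and> openin (subtopology (besicovitch_topology 2) G) T"
    then obtain U where U: "besicovitch_open 2 U" "T = U \<inter> G" "g \<in> U"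
      by (auto simp: openin_subtopology openin_besicovitch_topology)
    then obtain \<epsilon> where \<epsilon>: "\<epsilon> > 0" "\<And>h. h \<in> besicovitch_space 2 \<Longrightarrow>
        besicovitch_seminorm 2 (\<lambda>t. h t - g t) < ennreal \<epsilon> \<Longrightarrow> h \<in> U"
      unfolding besicovitch_open_def by blast
    have "\<epsilon>\<^sup>2 / 2 > 0" using \<epsilon>(1) by simp
    then obtain \<tau> where \<tau>: "\<forall>\<^sub>F l in at_top. window_energy (\<lambda>t. f (t + \<tau>) - g t) l < \<epsilon>\<^sup>2 / 2"
      using translates_approximate[of f g lam \<Lambda> "\<epsilon>\<^sup>2 / 2"] assms(2) \<open>g \<in> G\<close> G by blast
    have f\<tau>: "(\<lambda>t. f (t + \<tau>)) \<in> translates f"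
      by (auto simp: translates_def)
    have "besicovitch_seminorm 2 (\<lambda>t. f (t + \<tau>) - g t) < ennreal \<epsilon>"
    proof (rule seminorm_less_of_eventually_energy)
      show "locally_integrable 2 (\<lambda>t. f (t + \<tau>) - g t)"
        using f\<tau> translates G_space \<open>g \<in> G\<close>
        by (intro locally_integrable_2_diff besicovitch_space_2_locally_integrable) auto
      show "\<forall>\<^sub>F l in at_top. window_energy (\<lambda>t. f (t + \<tau>) - g t) l \<le> \<epsilon>\<^sup>2 / 2"
        using \<tau> by eventually_elim simp
    qed (use \<epsilon>(1) in auto)
    then have "(\<lambda>t. f (t + \<tau>)) \<in> U"
      using \<epsilon>(2) f\<tau> translates G_space by blast
    then show "\<exists>h. h \<in> translates f \<and> h \<in> T"
      using f\<tau> translates U(2) by blast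
  qed
  moreover have "subtopology (besicovitch_topology 2) G closure_of translates f \<subseteq> G"
    using closure_of_subset_topspace[of "subtopology (besicovitch_topology 2) G"] by (simp only: space)
  ultimately show ?thesis
    using translates by blast
qed

end
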